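(* Let $T$ be a spherically homogeneous rooted tree in which every vertex has at least $2$ children, and let $G\le \mathrm{Aut}~T$ be a finitely generated branch group. Then $G$ does not have the local retraction property $\mathrm{(LR)}$.
   Context: $\mathrm{Aut}~T$ is the group of automorphisms of $T$ fixing the root. The $n$th level $\mathcal{L}_n$ is the set of vertices at distance $n$ from the root. For a vertex $v$, $T_v$ is the subtree of descendants of $v$ (including $v$). For $G\le\mathrm{Aut}~T$, the rigid vertex stabilizer $\mathrm{rist}_G(v)$ is the subgroup of elements of $G$ fixing every vertex not in $T_v$, and the rigid level stabilizer is $\mathrm{Rist}_G(n)=\prod_{v\in\mathcal{L}_n}\mathrm{rist}_G(v)$ (an internal direct product). $G$ is level-transitive if it acts transitively on every level $\mathcal{L}_n$. $G$ is branch if it is level-transitive and $\mathrm{Rist}_G(n)$ has finite index in $G$ for every $n\ge1$. A subgroup $H\le G$ is a virtual retract of $G$ if there is a finite-index subgroup $K\le G$ containing $H$ and a homomorphism $K\to H$ restricting to the identity on $H$. $G$ has property $\mathrm{(LR)}$ if every finitely generated subgroup of $G$ is a virtual retract of $G$. *)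

theory Defs
  imports "HOL-Algebra.Algebra"
begin

text \<open>Spherically homogeneous rooted tree with branching sequence m:
  vertices are finite words v with v!i < m i; the root is the empty word;
  the parent of u@[a] is u.\<close>

definition verts :: "(nat \<Rightarrow> nat) \<Rightarrow> nat list set" where
  "verts m = {v. \<forall>i<length v. v ! i < m i}"

definition level :: "(nat \<Rightarrow> nat) \<Rightarrow> nat \<Rightarrow> nat list set" where
  "level m n = {v \<in> verts m. length v = n}"

definition adjacent :: "nat list \<Rightarrow> nat list \<Rightarrow> bool" where
  "adjacent u w \<longleftrightarrow> (\<exists>a. w = u @ [a] \<or> u = w @ [a])"

definition subtree :: "(nat \<Rightarrow> nat) \<Rightarrow> nat list \<Rightarrow> nat list set" where
  "subtree m v = {w \<in> verts m. (\<exists>u. w = v @ u)}"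

definition tree_aut :: "(nat \<Rightarrow> nat) \<Rightarrow> (nat list \<Rightarrow> nat list) set" where
  "tree_aut m = {g. bij_betw g (verts m) (verts m) \<and> g [] = []
      \<and> (\<forall>u\<in>verts m. \<forall>w\<in>verts m. adjacent u w \<longleftrightarrow> adjacent (g u) (g w))
      \<and> (\<forall>x. x \<notin> verts m \<longrightarrow> g x = x)}"

definition AutT :: "(nat \<Rightarrow> nat) \<Rightarrow> (nat list \<Rightarrow> nat list) monoid" where
  "AutT m = \<lparr>carrier = tree_aut m, monoid.mult = (\<lambda>g h. g \<circ> h), one = id\<rparr>"

definition rist :: "(nat \<Rightarrow> nat) \<Rightarrow> (nat list \<Rightarrow> nat list) set \<Rightarrow> nat list \<Rightarrow> (nat list \<Rightarrow> nat list) set" where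
  "rist m G v = {g \<in> G. \<forall>w\<in>verts m. w \<notin> subtree m v \<longrightarrow> g w = w}"

text \<open>Rigid level stabilizer: the (internal direct) product of the rist's of the
  vertices of level n, i.e. the subgroup they generate.\<close>
definition Rist :: "(nat \<Rightarrow> nat) \<Rightarrow> (nat list \<Rightarrow> nat list) set \<Rightarrow> nat \<Rightarrow> (nat list \<Rightarrow> nat list) set" where
  "Rist m G n = generate (AutT m) (\<Union>v\<in>level m n. rist m G v)"

definition finite_index :: "(nat \<Rightarrow> nat) \<Rightarrow> (nat list \<Rightarrow> nat list) set \<Rightarrow> (nat list \<Rightarrow> nat list) set \<Rightarrow> bool" where
  "finite_index m K G \<longleftrightarrow> subgroup K ((AutT m)\<lparr>carrier := G\<rparr>)
      \<and> finite (rcosets\<^bsub>(AutT m)\<lparr>carrier := G\<rparr>\<^esub> K)"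

definition level_transitive :: "(nat \<Rightarrow> nat) \<Rightarrow> (nat list \<Rightarrow> nat list) set \<Rightarrow> bool" where
  "level_transitive m G \<longleftrightarrow> (\<forall>n. \<forall>u\<in>level m n. \<forall>w\<in>level m n. \<exists>g\<in>G. g u = w)"

definition branch :: "(nat \<Rightarrow> nat) \<Rightarrow> (nat list \<Rightarrow> nat list) set \<Rightarrow> bool" where
  "branch m G \<longleftrightarrow> subgroup G (AutT m) \<and> level_transitive m G
      \<and> (\<forall>n\<ge>1. finite_index m (Rist m G n) G)"

definition fin_gen :: "(nat \<Rightarrow> nat) \<Rightarrow> (nat list \<Rightarrow> nat list) set \<Rightarrow> bool" where
  "fin_gen m H \<longleftrightarrow> (\<exists>S. finite S \<and> S \<subseteq> H \<and> generate (AutT m) S = H)"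

definition virtual_retract :: "(nat \<Rightarrow> nat) \<Rightarrow> (nat list \<Rightarrow> nat list) set \<Rightarrow> (nat list \<Rightarrow> nat list) set \<Rightarrow> bool" where
  "virtual_retract m H G \<longleftrightarrow> (\<exists>K r. finite_index m K G \<and> H \<subseteq> K
      \<and> r \<in> hom ((AutT m)\<lparr>carrier := K\<rparr>) ((AutT m)\<lparr>carrier := H\<rparr>)
      \<and> (\<forall>h\<in>H. r h = h))"

definition LR :: "(nat \<Rightarrow> nat) \<Rightarrow> (nat list \<Rightarrow> nat list) set \<Rightarrow> bool" where
  "LR m G \<longleftrightarrow> (\<forall>H. subgroup H ((AutT m)\<lparr>carrier := G\<rparr>) \<and> fin_gen m H
      \<longrightarrow> virtual_retract m H G)"

end

theory Submission
  imports Defs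
begin

text \<open>
  Suppose that the branch group \<open>G\<close> has local retractions. For every finite-index subgroup \<open>K\<close>
  and every vertex \<open>v\<close>, an element of \<open>G\<close> that commutes with \<open>K \<inter> rist v\<close> fixes all vertices
  below \<open>v\<close>; in particular \<open>K \<inter> rist v\<close> has trivial centralizer in \<open>rist v\<close>. Both groups are
  finitely generated unless \<open>v\<close> is the root.

  Let \<open>s \<in> R = rist v\<close>, let \<open>r : K \<rightarrow> \<langle>s\<rangle>\<close> be a virtual retraction, and let \<open>\<phi>\<close> be the conjugation
  of \<open>R\<close> onto the rigid stabilizer of another vertex of the same level. In the direct product
  \<open>L = (K \<inter> R) \<cdot> \<phi>(K \<inter> R)\<close> the fiber product \<open>Q = {a \<cdot> \<phi> b | r a = r b}\<close> is finitely generated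
  because \<open>r\<close> splits, normal because \<open>\<langle>s\<rangle>\<close> is abelian, and has trivial centralizer. A virtual
  retraction onto such a subgroup is the identity wherever it is defined on \<open>L\<close>, so some power
  \<open>s\<^sup>k = s\<^sup>k \<cdot> \<phi> 1\<close> with \<open>k > 0\<close> lies in \<open>Q\<close>; that is, \<open>s\<^sup>k = r (s\<^sup>k) = r 1 = 1\<close>.

  Hence \<open>G\<close> contains an element \<open>t\<close> of prime order \<open>p\<close>, moving some vertex \<open>v\<close>. The conjugates of
  \<open>R = rist v\<close> by \<open>t\<^sup>i\<close>, \<open>i < p\<close>, commute pairwise, and their diagonal \<open>D\<close> commutes with \<open>t\<close>. Let \<open>N\<close>
  be the kernel of a virtual retraction \<open>K \<rightarrow> \<langle>t, D\<rangle>\<close>. Since an element of \<open>N \<inter> R\<close> gives one of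
  \<open>N \<inter> D\<close>, the group \<open>N \<inter> R\<close> is trivial. If \<open>n \<in> N\<close> moves \<open>w\<close> below \<open>v\<close>, then \<open>N\<close> contains the
  commutators of \<open>K \<inter> rist w\<close>; so \<open>N\<close> centralizes \<open>R\<close>. As \<open>\<langle>t, D\<rangle>\<close> commutes with \<open>t\<close>, this forces
  \<open>K \<inter> R\<close> to centralize \<open>R\<close>, so \<open>K \<inter> R\<close> is trivial, which is absurd.
\<close>

section \<open>Finite generation and finite index\<close>

definition finitely_generated :: "('a, 'b) monoid_scheme \<Rightarrow> 'a set \<Rightarrow> bool" where
  "finitely_generated G H \<longleftrightarrow> (\<exists>S\<subseteq>carrier G. finite S \<and> generate G S = H)"

definition finite_index_subgroup :: "'a set \<Rightarrow> ('a, 'b) monoid_scheme \<Rightarrow> bool" where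
  "finite_index_subgroup K G \<longleftrightarrow> subgroup K G \<and> finite (rcosets\<^bsub>G\<^esub> K)"

definition Schreier_generators :: "('a, 'b) monoid_scheme \<Rightarrow> 'a set \<Rightarrow> 'a set \<Rightarrow> 'a set \<Rightarrow> 'a set" where
  "Schreier_generators G K T S =
     K \<inter> (\<lambda>(t, s, t'). t \<otimes>\<^bsub>G\<^esub> s \<otimes>\<^bsub>G\<^esub> inv\<^bsub>G\<^esub> t') ` (T \<times> S \<times> T)"

lemma (in group) finitely_generated_imp_subgroup: "finitely_generated G H \<Longrightarrow> subgroup H G"
  by (auto simp: finitely_generated_def generate_is_subgroup)

lemma (in group) finitely_generated_consistent:
  assumes "subgroup H G" "K \<subseteq> H"
  shows "finitely_generated (G\<lparr>carrier := H\<rparr>) K \<longleftrightarrow> finitely_generated G K"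
proof
  assume "finitely_generated (G\<lparr>carrier := H\<rparr>) K"
  then obtain S where "S \<subseteq> H" "finite S" "generate G S = K"
    using generate_consistent[OF _ assms(1)] by (auto simp: finitely_generated_def)
  then show "finitely_generated G K"
    using subgroup.subset[OF assms(1)] by (auto simp: finitely_generated_def)
next
  assume "finitely_generated G K"
  then obtain S where S: "S \<subseteq> carrier G" "finite S" "generate G S = K"
    by (auto simp: finitely_generated_def)
  then have "S \<subseteq> H" using assms(2) by (auto intro: generate.incl)
  then show "finitely_generated (G\<lparr>carrier := H\<rparr>) K"
    using S generate_consistent[OF _ assms(1)] by (auto simp: finitely_generated_def)
qed

lemma (in group_hom) finitely_generated_image:
  assumes "finitely_generated G K"
  shows "finitely_generated H (h ` K)"
proof -
  obtain S where S: "S \<subseteq> carrier G" "finite S" "generate G S = K"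
    using assms by (auto simp: finitely_generated_def)
  moreover have "h ` S \<subseteq> carrier H" using S(1) by auto
  ultimately show ?thesis
    using generate_img[OF S(1)] by (auto simp: finitely_generated_def)
qed

context group
begin

lemma finite_index_transversal:
  assumes "finite_index_subgroup K G"
  obtains T where "finite T" "T \<subseteq> carrier G" "carrier G \<subseteq> K <#> T"
proof
  have K: "subgroup K G" and fin: "finite (rcosets K)"
    using assms by (auto simp: finite_index_subgroup_def)
  define rep where "rep = (\<lambda>C :: 'a set. SOME x. x \<in> C)"
  have rep: "rep C \<in> C" if "C \<in> rcosets K" for C
    using subgroup.rcosets_non_empty[OF K that] by (auto simp: rep_def some_in_eq)
  show "finite (rep ` (rcosets K))" using fin by simp
  show "rep ` (rcosets K) \<subseteq> carrier G"
    using rep subgroup.rcosets_carrier[OF K is_group] by blast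
  show "carrier G \<subseteq> K <#> rep ` (rcosets K)"
  proof
    fix x assume x: "x \<in> carrier G"
    then have C: "K #> x \<in> rcosets K" using rcosetsI subgroup.subset[OF K] by blast
    have "x \<in> K #> rep (K #> x)"
      using repr_independence[OF rep[OF C] x K] rcos_self[OF x K] by simp
    then show "x \<in> K <#> rep ` (rcosets K)" using C by (auto simp: r_coset_def set_mult_def)
  qed
qed

lemma finite_index_pigeonhole:
  fixes f :: "nat \<Rightarrow> 'a"
  assumes "finite_index_subgroup K G" and f: "\<And>i. f i \<in> carrier G"
  obtains i j where "i < j" "f j \<otimes> inv (f i) \<in> K"
proof -
  have K: "subgroup K G" and fin: "finite (rcosets K)"
    using assms by (auto simp: finite_index_subgroup_def)
  have "range (\<lambda>i. K #> f i) \<subseteq> rcosets K"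
    using f rcosetsI subgroup.subset[OF K] by blast
  then have "\<not> inj (\<lambda>i. K #> f i)"
    using fin finite_subset range_inj_infinite by blast
  then obtain i j where i_less_j: "i < j" "K #> f i = K #> f j"
    by (metis injI linorder_neqE_nat)
  then have "f j \<in> K #> f i" using rcos_self[OF f K] by simp
  then show ?thesis using that[OF i_less_j(1)] subgroup.rcos_module_imp[OF K is_group f] by blast
qed

lemma finite_index_meets_infinite_subgroup:
  assumes K: "finite_index_subgroup K G" and L: "subgroup L G" "infinite L"
  obtains x where "x \<in> K" "x \<in> L" "x \<noteq> \<one>"
proof -
  obtain f :: "nat \<Rightarrow> 'a" where f: "inj f" "range f \<subseteq> L"
    using infinite_countable_subset[OF L(2)] by blast
  have f_in_L: "f i \<in> L" and f_in_G: "f i \<in> carrier G" for i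
    using f(2) subgroup.subset[OF L(1)] by auto
  obtain i j where i_less_j: "i < j" "f j \<otimes> inv (f i) \<in> K"
    using finite_index_pigeonhole[OF K f_in_G] .
  have "f j \<otimes> inv (f i) \<noteq> \<one>"
    using i_less_j(1) inj_onD[OF f(1), of j i] f_in_G inv_equality[of "f j" "inv (f i)"] by auto
  moreover have "f j \<otimes> inv (f i) \<in> L"
    using f_in_L L(1) by (simp add: subgroup.m_closed subgroup.m_inv_closed)
  ultimately show ?thesis using that i_less_j(2) by blast
qed

lemma finite_index_power:
  assumes K: "finite_index_subgroup K G" and x: "x \<in> carrier G"
  obtains k :: nat where "k > 0" "x [^] k \<in> K"
proof -
  obtain i j :: nat where i_less_j: "i < j" "x [^] j \<otimes> inv (x [^] i) \<in> K"
    using finite_index_pigeonhole[OF K, of "\<lambda>i. x [^] i"] x by auto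
  have "x [^] (j - i) \<otimes> x [^] i = x [^] j" using i_less_j(1) x by (simp add: nat_pow_mult)
  then have "x [^] (j - i) = x [^] j \<otimes> inv (x [^] i)"
    using x by (simp add: inv_solve_right)
  then show ?thesis using that[of "j - i"] i_less_j by simp
qed

lemma finite_index_Int:
  assumes "finite_index_subgroup K G" and L: "subgroup L G"
  shows "finite_index_subgroup (K \<inter> L) (G\<lparr>carrier := L\<rparr>)"
proof -
  have K: "subgroup K G" and fin: "finite (rcosets K)"
    using assms by (auto simp: finite_index_subgroup_def)
  have coset: "(K \<inter> L) #> l = (K #> l) \<inter> L" if l: "l \<in> L" for l
  proof
    show "(K \<inter> L) #> l \<subseteq> (K #> l) \<inter> L"
      using l subgroup.m_closed[OF L] by (auto simp: r_coset_def)
    show "(K #> l) \<inter> L \<subseteq> (K \<inter> L) #> l"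
    proof
      fix x assume "x \<in> (K #> l) \<inter> L"
      then obtain k where k: "k \<in> K" "x = k \<otimes> l" "x \<in> L" by (auto simp: r_coset_def)
      have "k = x \<otimes> inv l"
        using k l subgroup.mem_carrier[OF K] subgroup.mem_carrier[OF L] by (simp add: m_assoc)
      then have "k \<in> L" using k(3) l L by (simp add: subgroup.m_closed subgroup.m_inv_closed)
      then show "x \<in> (K \<inter> L) #> l" using k by (auto simp: r_coset_def)
    qed
  qed
  have "rcosets\<^bsub>G\<lparr>carrier := L\<rparr>\<^esub> (K \<inter> L) = (\<lambda>l. (K \<inter> L) #> l) ` L"
    by (auto simp: RCOSETS_def r_coset_def)
  also have "\<dots> = (\<lambda>l. (K #> l) \<inter> L) ` L" using coset by simp
  also have "\<dots> \<subseteq> (\<lambda>C. C \<inter> L) ` (rcosets K)"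
    using rcosetsI[OF subgroup.subset[OF K] subgroup.mem_carrier[OF L]] by blast
  finally have "finite (rcosets\<^bsub>G\<lparr>carrier := L\<rparr>\<^esub> (K \<inter> L))"
    using fin finite_surj by blast
  moreover have "subgroup (K \<inter> L) (G\<lparr>carrier := L\<rparr>)"
    by (rule subgroup_incl[OF subgroups_Inter_pair[OF K L] L]) simp
  ultimately show ?thesis by (simp add: finite_index_subgroup_def)
qed

lemma generate_subset_right_closed:
  assumes S: "S \<subseteq> carrier G" and M: "M \<subseteq> carrier G" "\<one> \<in> M"
    and closed: "\<And>x s. x \<in> M \<Longrightarrow> s \<in> S \<Longrightarrow> x \<otimes> s \<in> M"
      "\<And>x s. x \<in> M \<Longrightarrow> s \<in> S \<Longrightarrow> x \<otimes> inv s \<in> M"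
  shows "generate G S \<subseteq> M"
proof
  have right_closed: "x \<otimes> h \<in> M" if "h \<in> generate G S" "x \<in> M" for h x
    using that
  proof (induction arbitrary: x)
    case one
    then show ?case using M(1) by auto
  next
    case (incl s)
    then show ?case using closed(1) by blast
  next
    case (inv s)
    then show ?case using closed(2) by blast
  next
    case (eng h1 h2)
    have "h1 \<in> carrier G" "h2 \<in> carrier G" "x \<in> carrier G"
      using eng M(1) generate_in_carrier[OF S] by auto
    then have "x \<otimes> (h1 \<otimes> h2) = (x \<otimes> h1) \<otimes> h2" by (simp add: m_assoc)
    then show ?case using eng by simp
  qed
  fix h assume h: "h \<in> generate G S"
  then have "\<one> \<otimes> h \<in> M" by (rule right_closed[OF _ M(2)])
  then show "h \<in> M" using generate_in_carrier[OF S h] by simp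
qed

lemma Schreier_transversal:
  assumes K: "subgroup K G" and T: "T \<subseteq> carrier G" "\<one> \<in> T" "carrier G \<subseteq> K <#> T"
    and S: "S \<subseteq> carrier G" "\<And>s. s \<in> S \<Longrightarrow> inv s \<in> S" "generate G S = carrier G"
  shows "carrier G \<subseteq> generate G (Schreier_generators G K T S) <#> T"
proof -
  let ?W = "Schreier_generators G K T S"
  let ?L = "generate G ?W"
  have K_carrier: "K \<subseteq> carrier G" by (rule subgroup.subset[OF K])
  have W: "?W \<subseteq> carrier G" using K_carrier by (auto simp: Schreier_generators_def)
  have L: "subgroup ?L G" by (rule generate_is_subgroup[OF W])
  have "generate G S \<subseteq> ?L <#> T"
  proof (rule generate_subset_right_closed[OF S(1)])
    show "?L <#> T \<subseteq> carrier G" using generate_incl[OF W] T(1) by (rule set_mult_closed)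
    have "\<one> \<otimes> \<one> \<in> ?L <#> T"
      using subgroup.one_closed[OF L] T(2) unfolding set_mult_def by blast
    then show "\<one> \<in> ?L <#> T" by simp
    show closed: "x \<otimes> s \<in> ?L <#> T" if x: "x \<in> ?L <#> T" and s: "s \<in> S" for x s
    proof -
      obtain y t where y: "y \<in> ?L" "t \<in> T" "x = y \<otimes> t"
        using x by (auto simp: set_mult_def)
      have "t \<otimes> s \<in> K <#> T" using T(1,3) S(1) y(2) s by blast
      then obtain k t' where k: "k \<in> K" "t' \<in> T" "t \<otimes> s = k \<otimes> t'"
        by (auto simp: set_mult_def)
      have in_carrier: "y \<in> carrier G" "t \<in> carrier G" "s \<in> carrier G"
        "k \<in> carrier G" "t' \<in> carrier G"
        using y k s generate_in_carrier[OF W] K_carrier T(1) S(1) by auto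
      have "k = t \<otimes> s \<otimes> inv t'" using k(3) in_carrier by (simp add: m_assoc)
      then have "k \<in> ?W"
        unfolding Schreier_generators_def
        by (intro IntI k(1) rev_image_eqI[of "(t, s, t')"]) (use y(2) s k(2) in auto)
      then have "y \<otimes> k \<in> ?L" using y(1) subgroup.m_closed[OF L] by (simp add: generate.incl)
      moreover have "x \<otimes> s = (y \<otimes> k) \<otimes> t'" using k(3) in_carrier y(3) by (simp add: m_assoc)
      ultimately show ?thesis using k(2) unfolding set_mult_def by blast
    qed
    show "x \<otimes> inv s \<in> ?L <#> T" if "x \<in> ?L <#> T" "s \<in> S" for x s
      using closed that S(2) by blast
  qed
  then show ?thesis using S(3) by simp
qed

lemma Schreier:
  assumes K: "subgroup K G" and T: "T \<subseteq> carrier G" "\<one> \<in> T" "carrier G \<subseteq> K <#> T"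
    and S: "S \<subseteq> carrier G" "\<one> \<in> S" "\<And>s. s \<in> S \<Longrightarrow> inv s \<in> S" "generate G S = carrier G"
  shows "generate G (Schreier_generators G K T S) = K"
proof
  let ?W = "Schreier_generators G K T S"
  let ?L = "generate G ?W"
  show L_subset_K: "?L \<subseteq> K"
    by (rule generate_subgroup_incl[OF _ K]) (simp add: Schreier_generators_def)
  have K_carrier: "K \<subseteq> carrier G" by (rule subgroup.subset[OF K])
  show "K \<subseteq> ?L"
  proof
    fix k assume k: "k \<in> K"
    then have "k \<in> ?L <#> T" using Schreier_transversal[OF K T S(1,3,4)] K_carrier by blast
    then obtain y t where y: "y \<in> ?L" "t \<in> T" "k = y \<otimes> t"
      by (auto simp: set_mult_def)
    have in_carrier: "y \<in> carrier G" "t \<in> carrier G" using y L_subset_K K_carrier T(1) by auto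
    have "t = inv y \<otimes> k" using y(3) in_carrier by (simp add: m_assoc[symmetric])
    then have "t \<in> K"
      using y(1) k L_subset_K subgroup.m_closed[OF K] subgroup.m_inv_closed[OF K] by blast
    then have "t \<in> ?W"
      unfolding Schreier_generators_def
      by (intro IntI rev_image_eqI[of "(t, \<one>, \<one>)"]) (use y(2) T(2) S(2) in_carrier in auto)
    then have "y \<otimes> t \<in> ?L" by (intro generate.eng y(1) generate.incl)
    then show "k \<in> ?L" using y(3) by simp
  qed
qed

lemma finitely_generated_finite_index:
  assumes G: "finitely_generated G (carrier G)" and K: "finite_index_subgroup K G"
  shows "finitely_generated G K"
proof -
  obtain S where S: "S \<subseteq> carrier G" "finite S" "generate G S = carrier G"
    using G by (auto simp: finitely_generated_def)
  obtain T where T: "finite T" "T \<subseteq> carrier G" "carrier G \<subseteq> K <#> T"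
    using finite_index_transversal[OF K] .
  let ?S = "insert \<one> (S \<union> m_inv G ` S)" and ?T = "insert \<one> T"
  let ?W = "Schreier_generators G K ?T ?S"
  have S': "?S \<subseteq> carrier G" using S(1) by auto
  have "generate G ?S = carrier G"
    using generate_incl[OF S'] mono_generate[of S ?S] S(3) by blast
  moreover have "carrier G \<subseteq> K <#> ?T" using T(3) mono_set_mult[of K K T ?T] by blast
  moreover have "inv s \<in> ?S" if "s \<in> ?S" for s using that S(1) by auto
  moreover have "subgroup K G" using K by (simp add: finite_index_subgroup_def)
  ultimately have generates: "generate G ?W = K" using T(2) S' by (intro Schreier) auto
  then have "?W \<subseteq> K" by (auto intro: generate.incl)
  then have "?W \<subseteq> carrier G" using subgroup.subset[OF \<open>subgroup K G\<close>] by blast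
  moreover have "finite ?W" using S(2) T(1) by (simp add: Schreier_generators_def)
  ultimately show ?thesis using generates unfolding finitely_generated_def by blast
qed

lemma finitely_generated_Int_finite_index:
  assumes R: "finitely_generated G R" and K: "finite_index_subgroup K G"
  shows "finitely_generated G (K \<inter> R)"
proof -
  have R_subgroup: "subgroup R G" by (rule finitely_generated_imp_subgroup[OF R])
  interpret R: group "G\<lparr>carrier := R\<rparr>" by (rule subgroup_imp_group[OF R_subgroup])
  have "finitely_generated (G\<lparr>carrier := R\<rparr>) (K \<inter> R)"
    using R.finitely_generated_finite_index finite_index_Int[OF K R_subgroup] R
      finitely_generated_consistent[OF R_subgroup] by simp
  then show ?thesis using finitely_generated_consistent[OF R_subgroup] by simp
qed

end

section \<open>Centralizers and conjugation\<close>

definition centralizer :: "('a, 'b) monoid_scheme \<Rightarrow> 'a set \<Rightarrow> 'a set" where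
  "centralizer G A = {x \<in> carrier G. \<forall>a\<in>A. x \<otimes>\<^bsub>G\<^esub> a = a \<otimes>\<^bsub>G\<^esub> x}"

definition conjugate :: "('a, 'b) monoid_scheme \<Rightarrow> 'a \<Rightarrow> 'a \<Rightarrow> 'a" where
  "conjugate G g x = g \<otimes>\<^bsub>G\<^esub> x \<otimes>\<^bsub>G\<^esub> inv\<^bsub>G\<^esub> g"

definition commutator :: "('a, 'b) monoid_scheme \<Rightarrow> 'a \<Rightarrow> 'a \<Rightarrow> 'a" where
  "commutator G a b = conjugate G a b \<otimes>\<^bsub>G\<^esub> inv\<^bsub>G\<^esub> b"

context group
begin

lemma conjugate_closed [simp]:
  "g \<in> carrier G \<Longrightarrow> x \<in> carrier G \<Longrightarrow> conjugate G g x \<in> carrier G"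
  by (simp add: conjugate_def)

lemma conjugate_mult:
  assumes "g \<in> carrier G" "x \<in> carrier G" "y \<in> carrier G"
  shows "conjugate G g (x \<otimes> y) = conjugate G g x \<otimes> conjugate G g y"
proof -
  have "inv g \<otimes> (g \<otimes> z) = z" if "z \<in> carrier G" for z
    using assms(1) that by (simp flip: m_assoc)
  then show ?thesis using assms by (simp add: conjugate_def m_assoc)
qed

lemma conjugate_conjugate:
  assumes "g \<in> carrier G" "h \<in> carrier G" "x \<in> carrier G"
  shows "conjugate G g (conjugate G h x) = conjugate G (g \<otimes> h) x"
  using assms by (simp add: conjugate_def m_assoc inv_mult_group)

lemma conjugate_eq_iff:
  assumes "g \<in> carrier G" "x \<in> carrier G"
  shows "conjugate G g x = y \<longleftrightarrow> y \<in> carrier G \<and> g \<otimes> x = y \<otimes> g"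
proof
  assume "conjugate G g x = y"
  then show "y \<in> carrier G \<and> g \<otimes> x = y \<otimes> g"
    using assms by (auto simp: conjugate_def m_assoc)
next
  assume "y \<in> carrier G \<and> g \<otimes> x = y \<otimes> g"
  then show "conjugate G g x = y" using assms by (simp add: conjugate_def m_assoc)
qed

lemma conjugate_one [simp]: "x \<in> carrier G \<Longrightarrow> conjugate G \<one> x = x"
  by (simp add: conjugate_def)

lemma commutator_eq_one_imp_commute:
  assumes "a \<in> carrier G" "b \<in> carrier G" "commutator G a b = \<one>"
  shows "a \<otimes> b = b \<otimes> a"
proof -
  have "conjugate G a b = inv (inv b)"
    using assms inv_equality[of "conjugate G a b" "inv b"] by (simp add: commutator_def)
  then show ?thesis using assms by (simp add: conjugate_eq_iff)
qed

lemma commutator_in_subgroup: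
  "subgroup H G \<Longrightarrow> a \<in> H \<Longrightarrow> b \<in> H \<Longrightarrow> commutator G a b \<in> H"
  by (simp add: commutator_def conjugate_def subgroup.m_closed subgroup.m_inv_closed)

lemma conjugate_hom: "g \<in> carrier G \<Longrightarrow> conjugate G g \<in> hom G G"
  by (auto simp: hom_def conjugate_mult)

lemma inj_on_conjugate: "g \<in> carrier G \<Longrightarrow> inj_on (conjugate G g) (carrier G)"
  by (auto simp: inj_on_def conjugate_def)

lemma centralizer_subgroup:
  assumes A: "A \<subseteq> carrier G"
  shows "subgroup (centralizer G A) G"
proof (rule subgroupI)
  show "centralizer G A \<subseteq> carrier G" by (auto simp: centralizer_def)
  have "\<one> \<in> centralizer G A" using A by (auto simp: centralizer_def)
  then show "centralizer G A \<noteq> {}" by blast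
  fix x assume x: "x \<in> centralizer G A"
  then have x_carrier: "x \<in> carrier G" by (simp add: centralizer_def)
  have x_commutes: "x \<otimes> a = a \<otimes> x" if "a \<in> A" for a using that x by (simp add: centralizer_def)
  have "inv x \<otimes> a = a \<otimes> inv x" if a: "a \<in> A" for a
  proof -
    have a_carrier: "a \<in> carrier G" using a A by blast
    have "x \<otimes> (a \<otimes> inv x) = a" 
      using x_commutes[OF a] x_carrier a_carrier by (simp flip: m_assoc) (simp add: m_assoc)
    then show ?thesis using x_carrier a_carrier by (simp add: inv_solve_left')
  qed
  then show "inv x \<in> centralizer G A" using x_carrier by (simp add: centralizer_def)
  show "x \<otimes> y \<in> centralizer G A" if y: "y \<in> centralizer G A" for y
  proof -
    have y_carrier: "y \<in> carrier G" using y by (simp add: centralizer_def)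
    have "x \<otimes> y \<otimes> a = a \<otimes> (x \<otimes> y)" if a: "a \<in> A" for a
    proof -
      have a_carrier: "a \<in> carrier G" using a A by blast
      have "x \<otimes> y \<otimes> a = x \<otimes> a \<otimes> y"
        using x_carrier y_carrier a_carrier y a by (simp add: m_assoc centralizer_def)
      then show ?thesis using x_commutes[OF a] x_carrier y_carrier a_carrier by (simp add: m_assoc)
    qed
    then show ?thesis using x_carrier y_carrier by (simp add: centralizer_def)
  qed
qed

lemma subset_centralizer_commute:
  assumes "A \<subseteq> carrier G" "B \<subseteq> carrier G"
  shows "A \<subseteq> centralizer G B \<longleftrightarrow> B \<subseteq> centralizer G A"
  using assms by (fastforce simp: centralizer_def)

lemma generate_subset_centralizer:
  assumes "S \<subseteq> centralizer G A" "A \<subseteq> carrier G"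
  shows "generate G S \<subseteq> centralizer G A"
  by (rule generate_subgroup_incl[OF assms(1) centralizer_subgroup[OF assms(2)]])

lemma generate_singleton_commute:
  assumes s: "s \<in> carrier G" and xy: "x \<in> generate G {s}" "y \<in> generate G {s}"
  shows "x \<otimes> y = y \<otimes> x"
proof -
  let ?H = "generate G {s}"
  have H: "?H \<subseteq> carrier G" using generate_incl s by simp
  have "?H \<subseteq> centralizer G {s}"
    using s by (intro generate_subset_centralizer) (auto simp: centralizer_def)
  then have "{s} \<subseteq> centralizer G ?H" using subset_centralizer_commute[OF H] s by simp
  then have "?H \<subseteq> centralizer G ?H" by (rule generate_subset_centralizer[OF _ H])
  then show ?thesis using xy by (auto simp: centralizer_def)
qed

lemma conjugate_centralizer:
  assumes "g \<in> carrier G" "A \<subseteq> carrier G" "x \<in> centralizer G A"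
  shows "conjugate G g x \<in> centralizer G (conjugate G g ` A)"
proof -
  have "conjugate G g x \<otimes> conjugate G g a = conjugate G g a \<otimes> conjugate G g x" if "a \<in> A" for a
  proof -
    have "conjugate G g (x \<otimes> a) = conjugate G g (a \<otimes> x)"
      using assms(3) that by (simp add: centralizer_def)
    then show ?thesis
      using assms that conjugate_mult[of g x a] conjugate_mult[of g a x]
      by (auto simp: centralizer_def)
  qed
  then show ?thesis using assms by (auto simp: centralizer_def)
qed

end

lemma (in group) comm_group_generate_singleton:
  assumes "s \<in> carrier G"
  shows "comm_group (G\<lparr>carrier := generate G {s}\<rparr>)"
proof -
  interpret H: group "G\<lparr>carrier := generate G {s}\<rparr>"
    using assms by (intro subgroup_imp_group generate_is_subgroup) simp
  show ?thesis
    by (rule H.group_comm_groupI) (use generate_singleton_commute[OF assms] in simp)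
qed

lemma (in group) commuting_product_hom:
  assumes f: "f \<in> hom A G" and g: "g \<in> hom B G"
    and commute: "g ` carrier B \<subseteq> centralizer G (f ` carrier A)"
  shows "(\<lambda>(a, b). f a \<otimes> g b) \<in> hom (A \<times>\<times> B) G"
proof (rule homI)
  fix x y assume "x \<in> carrier (A \<times>\<times> B)" "y \<in> carrier (A \<times>\<times> B)"
  then obtain a b a' b' where ab: "x = (a, b)" "a \<in> carrier A" "b \<in> carrier B"
    "y = (a', b')" "a' \<in> carrier A" "b' \<in> carrier B" by auto
  have in_carrier: "f a \<in> carrier G" "g b \<in> carrier G" "f a' \<in> carrier G" "g b' \<in> carrier G"
    using ab hom_in_carrier[OF f] hom_in_carrier[OF g] by auto
  have "g b \<otimes> f a' = f a' \<otimes> g b" using commute ab by (auto simp: centralizer_def)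
  then have "f a \<otimes> f a' \<otimes> (g b \<otimes> g b') = f a \<otimes> g b \<otimes> (f a' \<otimes> g b')"
    using in_carrier by (metis m_assoc m_closed)
  then show "(case x \<otimes>\<^bsub>A \<times>\<times> B\<^esub> y of (a, b) \<Rightarrow> f a \<otimes> g b)
      = (case x of (a, b) \<Rightarrow> f a \<otimes> g b) \<otimes> (case y of (a, b) \<Rightarrow> f a \<otimes> g b)"
    using ab hom_mult[OF f] hom_mult[OF g] by simp
qed (use hom_in_carrier[OF f] hom_in_carrier[OF g] in auto)

lemma (in group_hom) hom_conjugate:
  "x \<in> carrier G \<Longrightarrow> y \<in> carrier G \<Longrightarrow> h (conjugate G x y) = conjugate H (h x) (h y)"
  by (simp add: conjugate_def)

lemma (in group_hom) centralizer_image: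
  assumes "inj_on h (carrier G)" "A \<subseteq> carrier G"
  shows "h ` carrier G \<inter> centralizer H (h ` A) = h ` centralizer G A"
proof
  show "h ` carrier G \<inter> centralizer H (h ` A) \<subseteq> h ` centralizer G A"
  proof
    fix y assume "y \<in> h ` carrier G \<inter> centralizer H (h ` A)"
    then obtain x where x: "x \<in> carrier G" "y = h x" "h x \<in> centralizer H (h ` A)" by auto
    have "x \<otimes> a = a \<otimes> x" if a: "a \<in> A" for a
    proof (rule inj_onD[OF assms(1)])
      show "h (x \<otimes> a) = h (a \<otimes> x)"
        using x a assms(2) by (auto simp: centralizer_def subset_iff)
    qed (use x a assms(2) in auto)
    then show "y \<in> h ` centralizer G A" using x by (auto simp: centralizer_def)
  qed
  show "h ` centralizer G A \<subseteq> h ` carrier G \<inter> centralizer H (h ` A)"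
    using assms(2) by (force simp: centralizer_def simp flip: hom_mult)
qed

section \<open>Virtual retractions\<close>

locale virtual_retraction = group G for G (structure) +
  fixes K H :: "'a set" and r :: "'a \<Rightarrow> 'a"
  assumes finite_index: "finite_index_subgroup K G"
    and H_subgroup: "subgroup H G"
    and H_subset_K: "H \<subseteq> K"
    and r_hom: "r \<in> hom (G\<lparr>carrier := K\<rparr>) (G\<lparr>carrier := H\<rparr>)"
    and r_fixes: "h \<in> H \<Longrightarrow> r h = h"
begin

lemma K_subgroup: "subgroup K G"
  using finite_index by (simp add: finite_index_subgroup_def)

lemma K_carrier: "x \<in> K \<Longrightarrow> x \<in> carrier G"
  by (rule subgroup.mem_carrier[OF K_subgroup])

lemma r_closed: "x \<in> K \<Longrightarrow> r x \<in> H"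
  using hom_in_carrier[OF r_hom] by simp

lemma r_group_hom: "group_hom (G\<lparr>carrier := K\<rparr>) (G\<lparr>carrier := H\<rparr>) r"
  by (intro group_hom.intro group_hom_axioms.intro subgroup_imp_group K_subgroup H_subgroup r_hom)

lemma r_mult: "x \<in> K \<Longrightarrow> y \<in> K \<Longrightarrow> r (x \<otimes> y) = r x \<otimes> r y"
  using hom_mult[OF r_hom] by simp

lemma r_one: "r \<one> = \<one>"
  by (rule r_fixes[OF subgroup.one_closed[OF H_subgroup]])

lemma r_inv: "x \<in> K \<Longrightarrow> r (inv x) = inv r x"
  using group_hom.hom_inv[OF r_group_hom] m_inv_consistent[OF K_subgroup]
    m_inv_consistent[OF H_subgroup r_closed] by simp

lemma r_conjugate: "x \<in> K \<Longrightarrow> y \<in> K \<Longrightarrow> r (conjugate G x y) = conjugate G (r x) (r y)"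
  using K_subgroup by (simp add: conjugate_def r_mult r_inv subgroup.m_closed subgroup.m_inv_closed)

lemma conjugate_closed_K: "x \<in> K \<Longrightarrow> y \<in> K \<Longrightarrow> conjugate G x y \<in> K"
  using K_subgroup by (simp add: conjugate_def subgroup.m_closed subgroup.m_inv_closed)

definition ker :: "'a set" where
  "ker = {n \<in> K. r n = \<one>}"

lemma ker_subgroup: "subgroup ker G"
proof -
  have "ker = kernel (G\<lparr>carrier := K\<rparr>) (G\<lparr>carrier := H\<rparr>) r" by (simp add: ker_def kernel_def)
  then show ?thesis
    using incl_subgroup[OF K_subgroup] group_hom.subgroup_kernel[OF r_group_hom] by simp
qed

lemma ker_conjugate: "x \<in> K \<Longrightarrow> n \<in> ker \<Longrightarrow> conjugate G x n \<in> ker"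
  using subgroup.mem_carrier[OF H_subgroup r_closed]
  by (simp add: ker_def conjugate_closed_K r_conjugate) (simp add: conjugate_def)

lemma ker_Int_H: "n \<in> ker \<Longrightarrow> n \<in> H \<Longrightarrow> n = \<one>"
  by (simp add: ker_def r_fixes)

lemma ker_component:
  assumes x: "x \<in> K"
  shows "x \<otimes> inv r x \<in> ker"
proof -
  have rx: "r x \<in> K" and r_carrier: "r x \<in> carrier G"
    using r_closed[OF x] H_subset_K K_carrier by auto
  then show ?thesis
    using x r_closed[OF x] K_subgroup
    by (simp add: ker_def r_mult r_inv r_fixes subgroup.m_closed subgroup.m_inv_closed)
qed

lemma ker_normalizing_commutes:
  assumes n: "n \<in> ker" and h: "h \<in> H" and nh: "conjugate G n h \<in> H"
  shows "n \<otimes> h = h \<otimes> n"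
proof -
  have in_K: "n \<in> K" "h \<in> K" "r n = \<one>" using n h H_subset_K by (auto simp: ker_def)
  have "conjugate G n h = r (conjugate G n h)" using r_fixes[OF nh] by simp
  also have "\<dots> = h" using in_K K_carrier by (simp add: r_conjugate r_fixes[OF h])
  finally show ?thesis using in_K K_carrier by (simp add: conjugate_eq_iff)
qed

lemma normalizing_subset_retract:
  assumes L: "subgroup L G" "H \<subseteq> L" and norm: "\<And>l h. l \<in> L \<Longrightarrow> h \<in> H \<Longrightarrow> conjugate G l h \<in> H"
    and centralizer: "L \<inter> centralizer G H \<subseteq> {\<one>}"
  shows "K \<inter> L \<subseteq> H"
proof
  fix x assume x: "x \<in> K \<inter> L"
  let ?n = "x \<otimes> inv r x"
  have rx: "r x \<in> H" and in_carrier: "x \<in> carrier G" "r x \<in> carrier G"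
    using x r_closed K_carrier H_subset_K by auto
  have n: "?n \<in> ker" using ker_component x by blast
  have "?n \<in> L" using x rx L by (auto intro!: subgroup.m_closed subgroup.m_inv_closed)
  moreover have "?n \<in> centralizer G H"
    using ker_normalizing_commutes[OF n] norm[OF \<open>?n \<in> L\<close>] in_carrier by (simp add: centralizer_def)
  ultimately have "?n = \<one>" using centralizer by blast
  then have "x = r x" using in_carrier inv_equality[of x "inv r x"] by simp
  then show "x \<in> H" using rx by simp
qed

text \<open>With \<open>c = [a, n] \<in> ker\<close> one has \<open>[c, b] = [a, b]\<close>.\<close>

lemma ker_commutator:
  assumes n: "n \<in> ker" and a: "a \<in> K" and b: "b \<in> K"
    and commute: "conjugate G n (inv a) \<otimes> b = b \<otimes> conjugate G n (inv a)"
  shows "commutator G a b \<in> ker"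
proof -
  let ?a' = "conjugate G n (inv a)"
  have in_K: "n \<in> K" "inv a \<in> K" "?a' \<in> K"
    using n a subgroup.m_inv_closed[OF K_subgroup] conjugate_closed_K by (auto simp: ker_def)
  have r_carrier: "r a \<in> carrier G" "r b \<in> carrier G"
    using a b r_closed subgroup.mem_carrier[OF H_subgroup] by auto
  have "r ?a' = inv r a"
    using n in_K a r_carrier by (simp add: ker_def r_conjugate r_inv)
  then have r_eq_one: "r (a \<otimes> ?a') = \<one>" using a in_K r_carrier by (simp add: r_mult)
  have "conjugate G ?a' b = b" using commute in_K b K_carrier by (simp add: conjugate_eq_iff)
  then have "conjugate G a b = conjugate G (a \<otimes> ?a') b"
    using a b in_K K_carrier conjugate_conjugate[of a ?a' b] by simp
  then have "r (conjugate G a b) = r b"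
    using a b in_K r_eq_one r_carrier subgroup.m_closed[OF K_subgroup] by (simp add: r_conjugate)
  then show ?thesis
    using a b r_carrier K_subgroup conjugate_closed_K[OF a b]
    by (simp add: commutator_def ker_def r_mult r_inv subgroup.m_closed subgroup.m_inv_closed)
qed

end

definition has_local_retractions :: "('a, 'b) monoid_scheme \<Rightarrow> bool" where
  "has_local_retractions G \<longleftrightarrow>
     (\<forall>H. finitely_generated G H \<longrightarrow> (\<exists>K r. virtual_retraction G K H r))"

section \<open>Fiber products\<close>

locale split_fiber_product =
  f: group_hom A C f + g: group_hom B C g + \<sigma>: group_hom C A \<sigma> + \<tau>: group_hom C B \<tau>
  for A :: "('a, 'm) monoid_scheme" and B :: "('b, 'n) monoid_scheme"
    and C :: "('c, 'k) monoid_scheme" and f g \<sigma> \<tau> +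
  assumes f_section: "c \<in> carrier C \<Longrightarrow> f (\<sigma> c) = c"
    and g_section: "c \<in> carrier C \<Longrightarrow> g (\<tau> c) = c"
begin

sublocale prod: group "A \<times>\<times> B"
  by (rule DirProd_group[OF f.G.is_group g.G.is_group])

definition fiber_product :: "('a \<times> 'b) set" where
  "fiber_product = {(a, b). a \<in> carrier A \<and> b \<in> carrier B \<and> f a = g b}"

lemma fiber_product_subset: "fiber_product \<subseteq> carrier (A \<times>\<times> B)"
  by (auto simp: fiber_product_def)

lemma fiber_product_subgroup: "subgroup fiber_product (A \<times>\<times> B)"
proof (rule prod.subgroupI[OF fiber_product_subset])
  have "(\<one>\<^bsub>A\<^esub>, \<one>\<^bsub>B\<^esub>) \<in> fiber_product" by (simp add: fiber_product_def)
  then show "fiber_product \<noteq> {}" by blast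
qed (auto simp: fiber_product_def f.G.is_group g.G.is_group)

lemma graph_homs:
  shows "(\<lambda>a. (a, \<tau> (f a))) \<in> hom A (A \<times>\<times> B)"
    and "(\<lambda>b. (\<sigma> (g b), b)) \<in> hom B (A \<times>\<times> B)"
  by (auto simp: hom_def)

lemma graphs_subset_fiber_product:
  shows "a \<in> carrier A \<Longrightarrow> (a, \<tau> (f a)) \<in> fiber_product"
    and "b \<in> carrier B \<Longrightarrow> (\<sigma> (g b), b) \<in> fiber_product"
  by (simp_all add: fiber_product_def f_section g_section)

text \<open>With \<open>c = f a = g b\<close>, one has \<open>(a, b) = (a, \<tau> c) \<cdot> (\<sigma> c, \<tau> c)\<^sup>-\<^sup>1 \<cdot> (\<sigma> c, b)\<close>.\<close>

lemma fiber_product_subset_graphs: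
  assumes L: "subgroup L (A \<times>\<times> B)"
    and graphs: "\<And>a. a \<in> carrier A \<Longrightarrow> (a, \<tau> (f a)) \<in> L" "\<And>b. b \<in> carrier B \<Longrightarrow> (\<sigma> (g b), b) \<in> L"
  shows "fiber_product \<subseteq> L"
proof
  fix x assume "x \<in> fiber_product"
  then obtain a b where ab: "a \<in> carrier A" "b \<in> carrier B" "f a = g b" "x = (a, b)"
    by (auto simp: fiber_product_def)
  let ?c = "f a"
  have in_carrier: "?c \<in> carrier C" "\<sigma> ?c \<in> carrier A" "\<tau> ?c \<in> carrier B" using ab by auto
  have "x = (a, \<tau> ?c) \<otimes>\<^bsub>A \<times>\<times> B\<^esub> inv\<^bsub>A \<times>\<times> B\<^esub> (\<sigma> ?c, \<tau> ?c) \<otimes>\<^bsub>A \<times>\<times> B\<^esub> (\<sigma> ?c, b)"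
    using ab in_carrier f.G.is_group g.G.is_group by (simp add: f.G.m_assoc g.G.m_assoc)
  moreover have "(a, \<tau> ?c) \<in> L" using graphs(1) ab(1) .
  moreover have "(\<sigma> ?c, b) \<in> L" using graphs(2)[OF ab(2)] ab(3) by simp
  moreover have "(\<sigma> ?c, \<tau> ?c) \<in> L"
    using graphs(1)[OF in_carrier(2)] f_section[OF in_carrier(1)] by simp
  ultimately show "x \<in> L" using subgroup.m_closed[OF L] subgroup.m_inv_closed[OF L] by simp
qed

lemma fiber_product_finitely_generated:
  assumes "finitely_generated A (carrier A)" "finitely_generated B (carrier B)"
  shows "finitely_generated (A \<times>\<times> B) fiber_product"
proof -
  obtain S T where S: "S \<subseteq> carrier A" "finite S" "generate A S = carrier A"
    and T: "T \<subseteq> carrier B" "finite T" "generate B T = carrier B"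
    using assms by (auto simp: finitely_generated_def)
  let ?\<alpha> = "\<lambda>a. (a, \<tau> (f a))" and ?\<beta> = "\<lambda>b. (\<sigma> (g b), b)"
  let ?W = "?\<alpha> ` S \<union> ?\<beta> ` T"
  have W: "?W \<subseteq> fiber_product" using graphs_subset_fiber_product S(1) T(1) by blast
  interpret \<alpha>: group_hom A "A \<times>\<times> B" ?\<alpha> by unfold_locales (rule graph_homs)
  interpret \<beta>: group_hom B "A \<times>\<times> B" ?\<beta> by unfold_locales (rule graph_homs)
  have "?\<alpha> ` carrier A \<subseteq> generate (A \<times>\<times> B) ?W"
    using \<alpha>.generate_img[OF S(1)] S(3) prod.mono_generate[of "?\<alpha> ` S" ?W] by simp
  moreover have "?\<beta> ` carrier B \<subseteq> generate (A \<times>\<times> B) ?W"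
    using \<beta>.generate_img[OF T(1)] T(3) prod.mono_generate[of "?\<beta> ` T" ?W] by simp
  moreover have W_subset: "?W \<subseteq> carrier (A \<times>\<times> B)" using W fiber_product_subset by blast
  ultimately have "fiber_product \<subseteq> generate (A \<times>\<times> B) ?W"
    by (intro fiber_product_subset_graphs prod.generate_is_subgroup) blast+
  moreover have "generate (A \<times>\<times> B) ?W \<subseteq> fiber_product"
    by (rule prod.generate_subgroup_incl[OF W fiber_product_subgroup])
  ultimately show ?thesis
    using W_subset S(2) T(2) by (auto simp: finitely_generated_def intro!: exI[of _ ?W])
qed

lemma conjugate_fiber_product:
  assumes C: "comm_group C" and x: "x \<in> carrier (A \<times>\<times> B)" and y: "y \<in> fiber_product"
  shows "conjugate (A \<times>\<times> B) x y \<in> fiber_product"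
proof -
  interpret C: comm_group C by fact
  obtain a b where x': "x = (a, b)" "a \<in> carrier A" "b \<in> carrier B" using x by auto
  obtain a' b' where y': "y = (a', b')" "a' \<in> carrier A" "b' \<in> carrier B" "f a' = g b'"
    using y by (auto simp: fiber_product_def)
  have "c \<otimes>\<^bsub>C\<^esub> z \<otimes>\<^bsub>C\<^esub> inv\<^bsub>C\<^esub> c = z" if "c \<in> carrier C" "z \<in> carrier C" for c z
    using that C.m_comm[of c z] by (simp add: f.H.m_assoc)
  then show ?thesis
    using x' y' f.G.is_group g.G.is_group by (simp add: conjugate_def fiber_product_def)
qed

lemma centralizer_fiber_product:
  "centralizer (A \<times>\<times> B) fiber_product
     \<subseteq> centralizer A (carrier A) \<times> centralizer B (carrier B)"
  using graphs_subset_fiber_product by (fastforce simp: centralizer_def)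

end

section \<open>Torsion\<close>

locale commuting_copies = virtual_retraction +
  fixes R :: "'a set" and \<phi> :: "'a \<Rightarrow> 'a"
  assumes H_comm: "comm_group (G\<lparr>carrier := H\<rparr>)" and H_subset_R: "H \<subseteq> R"
    and R_fin_gen: "finitely_generated G R"
    and center: "R \<inter> centralizer G (K \<inter> R) \<subseteq> {\<one>}"
    and \<phi>_hom: "\<phi> \<in> hom (G\<lparr>carrier := R\<rparr>) G" and inj_\<phi>: "inj_on \<phi> R"
    and \<phi>_commutes: "\<phi> ` R \<subseteq> centralizer G R"
begin

definition A :: "('a, 'b) monoid_scheme" where
  "A = G\<lparr>carrier := K \<inter> R\<rparr>"

definition pair :: "'a \<times> 'a \<Rightarrow> 'a" where
  "pair = (\<lambda>(a, b). a \<otimes> \<phi> b)"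

lemma R_subgroup: "subgroup R G"
  by (rule finitely_generated_imp_subgroup[OF R_fin_gen])

lemma A_subgroup: "subgroup (K \<inter> R) G"
  by (rule subgroups_Inter_pair[OF K_subgroup R_subgroup])

lemma carrier_A: "carrier A = K \<inter> R"
  by (simp add: A_def)

sublocale split_fiber_product A A "G\<lparr>carrier := H\<rparr>" r r "\<lambda>h. h" "\<lambda>h. h"
proof -
  have A: "group A" and H: "group (G\<lparr>carrier := H\<rparr>)"
    using A_subgroup H_subgroup subgroup_imp_group by (auto simp: A_def)
  have r: "group_hom A (G\<lparr>carrier := H\<rparr>) r"
    using A H r_closed r_mult
    by (auto simp: group_hom_def group_hom_axioms_def hom_def A_def)
  have incl: "group_hom (G\<lparr>carrier := H\<rparr>) A (\<lambda>h. h)"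
    using A H H_subset_K H_subset_R
    by (auto simp: group_hom_def group_hom_axioms_def hom_def A_def)
  show "split_fiber_product A A (G\<lparr>carrier := H\<rparr>) r r (\<lambda>h. h) (\<lambda>h. h)"
    by (intro split_fiber_product.intro split_fiber_product_axioms.intro r incl)
      (simp_all add: r_fixes)
qed

sublocale pair: group_hom "A \<times>\<times> A" G pair
proof -
  have "(\<lambda>a. a) \<in> hom A G" using K_carrier by (auto simp: hom_def A_def)
  moreover have "\<phi> \<in> hom A G" using \<phi>_hom by (auto simp: hom_def A_def)
  moreover have "\<phi> ` carrier A \<subseteq> centralizer G ((\<lambda>a. a) ` carrier A)"
    using \<phi>_commutes by (force simp: carrier_A centralizer_def)
  ultimately have "pair \<in> hom (A \<times>\<times> A) G"
    unfolding pair_def by (rule commuting_product_hom)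
  then show "group_hom (A \<times>\<times> A) G pair" by unfold_locales
qed

lemma \<phi>_one: "\<phi> \<one> = \<one>"
  using hom_one[OF \<phi>_hom subgroup_imp_group[OF R_subgroup] is_group] by simp

lemma inj_on_pair: "inj_on pair (carrier (A \<times>\<times> A))"
  unfolding pair.inj_on_one_iff
proof (intro allI impI)
  fix x assume x: "x \<in> carrier (A \<times>\<times> A)" and one: "pair x = \<one>"
  obtain a b where ab: "x = (a, b)" "a \<in> K" "a \<in> R" "b \<in> R"
    using x by (auto simp: carrier_A)
  have \<phi>b: "\<phi> b \<in> centralizer G R" using \<phi>_commutes ab by blast
  then have in_carrier: "a \<in> carrier G" "\<phi> b \<in> carrier G"
    using ab K_carrier by (auto simp: centralizer_def)
  have "a = inv \<phi> b" using inv_equality[of a "\<phi> b"] one in_carrier by (simp add: ab pair_def)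
  then have "\<phi> b = inv a" using in_carrier by simp
  then have "\<phi> b \<in> R" using ab subgroup.m_inv_closed[OF R_subgroup] by simp
  then have "\<phi> b = \<one>" using \<phi>b center by (auto simp: centralizer_def)
  then have "b = \<one>"
    using inj_onD[OF inj_\<phi>, of b \<one>] \<phi>_one ab(4) subgroup.one_closed[OF R_subgroup] by simp
  then show "x = \<one>\<^bsub>A \<times>\<times> A\<^esub>"
    using \<open>a = inv \<phi> b\<close> \<open>\<phi> b = \<one>\<close> ab by (simp add: A_def)
qed

definition fiber_subgroup :: "'a set" where
  "fiber_subgroup = pair ` fiber_product"

lemma fiber_subgroup_fin_gen: "finitely_generated G fiber_subgroup"
proof -
  have "finitely_generated A (carrier A)"
    using finitely_generated_Int_finite_index[OF R_fin_gen finite_index]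
      finitely_generated_consistent[OF A_subgroup] by (simp add: A_def)
  then show ?thesis
    unfolding fiber_subgroup_def
    by (intro pair.finitely_generated_image fiber_product_finitely_generated)
qed

lemma conjugate_fiber_subgroup:
  assumes "x \<in> pair ` carrier (A \<times>\<times> A)" "y \<in> fiber_subgroup"
  shows "conjugate G x y \<in> fiber_subgroup"
proof -
  obtain u w where u: "u \<in> carrier (A \<times>\<times> A)" "x = pair u" and w: "w \<in> fiber_product" "y = pair w"
    using assms unfolding fiber_subgroup_def by blast
  then have "conjugate G x y = pair (conjugate (A \<times>\<times> A) u w)"
    using pair.hom_conjugate[OF u(1) subsetD[OF fiber_product_subset w(1)]] by simp
  then show ?thesis
    using conjugate_fiber_product[OF H_comm u(1) w(1)] by (simp add: fiber_subgroup_def)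
qed

lemma centralizer_fiber_subgroup: "pair ` carrier (A \<times>\<times> A) \<inter> centralizer G fiber_subgroup \<subseteq> {\<one>}"
proof -
  have "centralizer A (carrier A) \<subseteq> {\<one>}"
    using center K_carrier by (auto simp: centralizer_def A_def)
  then have "centralizer (A \<times>\<times> A) fiber_product \<subseteq> {\<one>\<^bsub>A \<times>\<times> A\<^esub>}"
    using centralizer_fiber_product by (auto simp: A_def)
  then have "pair ` centralizer (A \<times>\<times> A) fiber_product \<subseteq> {\<one>}"
    using pair.hom_one by blast
  then show ?thesis
    unfolding fiber_subgroup_def
    using pair.centralizer_image[OF inj_on_pair fiber_product_subset] by blast
qed

lemma fiber_subgroup_retraction_Int_H:
  assumes "virtual_retraction G K' fiber_subgroup q"
  shows "K' \<inter> H \<subseteq> {\<one>}"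
proof
  interpret q: virtual_retraction G K' fiber_subgroup q by fact
  have L: "subgroup (pair ` carrier (A \<times>\<times> A)) G"
    by (rule pair.subgroup_img_is_subgroup[OF prod.subgroup_self])
  have "fiber_subgroup \<subseteq> pair ` carrier (A \<times>\<times> A)"
    unfolding fiber_subgroup_def by (intro image_mono fiber_product_subset)
  from q.normalizing_subset_retract[OF L this conjugate_fiber_subgroup centralizer_fiber_subgroup]
  have Int_subset: "K' \<inter> pair ` carrier (A \<times>\<times> A) \<subseteq> fiber_subgroup" .
  fix x assume x: "x \<in> K' \<inter> H"
  have x_one_in_carrier: "(x, \<one>) \<in> carrier (A \<times>\<times> A)"
    using x H_subset_K H_subset_R subgroup.one_closed[OF A_subgroup] by (auto simp: carrier_A)
  have pair_x: "pair (x, \<one>) = x"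
    using x subgroup.mem_carrier[OF H_subgroup] by (simp add: pair_def \<phi>_one)
  then have "x \<in> pair ` carrier (A \<times>\<times> A)" using x_one_in_carrier by (metis imageI)
  then have "pair (x, \<one>) \<in> fiber_subgroup" using Int_subset x pair_x by auto
  then have "(x, \<one>) \<in> fiber_product"
    unfolding fiber_subgroup_def
    using inj_on_image_mem_iff[OF inj_on_pair x_one_in_carrier fiber_product_subset] by simp
  then have "r x = r \<one>" by (simp add: fiber_product_def)
  then show "x \<in> {\<one>}" using x r_fixes r_one by auto
qed

end

lemma (in group) torsion_if_commuting_copy:
  assumes LR: "has_local_retractions G" and R: "finitely_generated G R"
    and center: "\<And>K. finite_index_subgroup K G \<Longrightarrow> R \<inter> centralizer G (K \<inter> R) \<subseteq> {\<one>}"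
    and \<phi>: "\<phi> \<in> hom (G\<lparr>carrier := R\<rparr>) G" "inj_on \<phi> R" "\<phi> ` R \<subseteq> centralizer G R"
    and s: "s \<in> R"
  shows "\<exists>k::nat>0. s [^] k = \<one>"
proof -
  have R_subgroup: "subgroup R G" by (rule finitely_generated_imp_subgroup[OF R])
  have s_carrier: "s \<in> carrier G" using s subgroup.mem_carrier[OF R_subgroup] by blast
  let ?H = "generate G {s}"
  have "finitely_generated G ?H" using s_carrier by (auto simp: finitely_generated_def)
  then obtain K r where retraction: "virtual_retraction G K ?H r"
    using LR by (auto simp: has_local_retractions_def)
  interpret r: virtual_retraction G K ?H r by fact
  have "commuting_copies G K ?H r R \<phi>"
  proof (intro commuting_copies.intro commuting_copies_axioms.intro)
    show "?H \<subseteq> R" by (rule generate_subgroup_incl[OF _ R_subgroup]) (simp add: s)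
  qed (use retraction comm_group_generate_singleton[OF s_carrier] R center[OF r.finite_index] \<phi>
      in auto)
  then interpret commuting_copies G K ?H r R \<phi> .
  obtain K' q where retraction': "virtual_retraction G K' fiber_subgroup q"
    using LR fiber_subgroup_fin_gen by (auto simp: has_local_retractions_def)
  then have "finite_index_subgroup K' G" by (rule virtual_retraction.finite_index)
  then obtain k :: nat where k: "k > 0" "s [^] k \<in> K'"
    using finite_index_power s_carrier by blast
  have "s [^] int k \<in> ?H"
    by (rule subgroup_int_pow_closed[OF r.H_subgroup]) (simp add: generate.incl)
  then have "s [^] k = \<one>"
    using fiber_subgroup_retraction_Int_H[OF retraction'] k(2) by (auto simp: int_pow_int)
  then show ?thesis using k(1) by blast
qed

section \<open>Diagonal subgroups\<close>

text \<open>\<open>(a t)\<^sup>k t\<^sup>-\<^sup>k\<close> is the product of the conjugates of \<open>a\<close> by \<open>t\<^sup>0, \<dots>, t\<^sup>k\<^sup>-\<^sup>1\<close>, in this order.\<close>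

definition conj_prod :: "('a, 'b) monoid_scheme \<Rightarrow> 'a \<Rightarrow> nat \<Rightarrow> 'a \<Rightarrow> 'a" where
  "conj_prod G t k a = (a \<otimes>\<^bsub>G\<^esub> t) [^]\<^bsub>G\<^esub> k \<otimes>\<^bsub>G\<^esub> inv\<^bsub>G\<^esub> (t [^]\<^bsub>G\<^esub> k)"

context group
begin

lemma conj_prod_closed [simp]:
  "t \<in> carrier G \<Longrightarrow> a \<in> carrier G \<Longrightarrow> conj_prod G t k a \<in> carrier G"
  by (simp add: conj_prod_def)

lemma conj_prod_0 [simp]: "conj_prod G t 0 a = \<one>"
  by (simp add: conj_prod_def)

lemma conj_prod_Suc:
  assumes "t \<in> carrier G" "a \<in> carrier G"
  shows "conj_prod G t (Suc k) a = conj_prod G t k a \<otimes> conjugate G (t [^] k) a"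
proof -
  have "inv (t [^] k) \<otimes> (t [^] k \<otimes> z) = z" "t \<otimes> (inv t \<otimes> z) = z" if "z \<in> carrier G" for z
    using assms(1) that by (simp_all flip: m_assoc)
  then show ?thesis
    using assms by (simp add: conj_prod_def conjugate_def inv_mult_group m_assoc)
qed

lemma conj_prod_Suc_left:
  assumes "t \<in> carrier G" "a \<in> carrier G"
  shows "conj_prod G t (Suc k) a = a \<otimes> conjugate G t (conj_prod G t k a)"
proof -
  have "(a \<otimes> t) [^] Suc k = a \<otimes> t \<otimes> (a \<otimes> t) [^] k" "t [^] Suc k = t \<otimes> t [^] k"
    using assms by (simp_all only: nat_pow_Suc2 m_closed)
  then show ?thesis
    using assms by (simp add: conj_prod_def conjugate_def inv_mult_group m_assoc del: nat_pow_Suc)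
qed

end

locale commuting_conjugates = group +
  fixes R :: "'a set" and t :: 'a and p :: nat
  assumes R_subgroup: "subgroup R G" and t_carrier: "t \<in> carrier G"
    and p_gt_1: "p > 1" and t_pow_p: "t [^] p = \<one>"
    and conjugates_commute: "0 < i \<Longrightarrow> i < p \<Longrightarrow> conjugate G (t [^] i) ` R \<subseteq> centralizer G R"
begin

lemma R_carrier: "a \<in> R \<Longrightarrow> a \<in> carrier G"
  by (rule subgroup.mem_carrier[OF R_subgroup])

lemma conjugate_pow_image:
  fixes i j :: nat
  shows "conjugate G (t [^] i) ` conjugate G (t [^] j) ` R = conjugate G (t [^] (i + j)) ` R"
  unfolding image_image
  by (rule image_cong) (simp_all add: R_carrier t_carrier conjugate_conjugate nat_pow_mult)

lemma conj_prod_in_centralizer: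
  assumes a: "a \<in> R" and "k \<le> j" "j < p"
  shows "conj_prod G t k a \<in> centralizer G (conjugate G (t [^] j) ` R)"
proof -
  have image_carrier: "conjugate G g ` R \<subseteq> carrier G" if "g \<in> carrier G" for g
    using R_carrier that by auto
  note C = centralizer_subgroup[OF image_carrier[OF nat_pow_closed[OF t_carrier, of j]]]
  show ?thesis
    using assms(2)
  proof (induction k)
    case 0
    then show ?case using subgroup.one_closed[OF C] by simp
  next
    case (Suc k)
    have "conjugate G (t [^] (j - k)) ` R \<subseteq> centralizer G R"
      using Suc.prems assms(3) by (intro conjugates_commute) auto
    then have "a \<in> centralizer G (conjugate G (t [^] (j - k)) ` R)"
      using subset_centralizer_commute[of "conjugate G (t [^] (j - k)) ` R" R] a R_carrier
        image_carrier t_carrier by blast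
    then have "conjugate G (t [^] k) a
        \<in> centralizer G (conjugate G (t [^] k) ` conjugate G (t [^] (j - k)) ` R)"
      using image_carrier t_carrier by (intro conjugate_centralizer) auto
    then have "conjugate G (t [^] k) a \<in> centralizer G (conjugate G (t [^] j) ` R)"
      using Suc.prems by (simp add: conjugate_pow_image)
    then show ?case
      using Suc subgroup.m_closed[OF C] a R_carrier t_carrier by (simp add: conj_prod_Suc)
  qed
qed

lemma conj_prod_mult:
  assumes ab: "a \<in> R" "b \<in> R" and "k \<le> p"
  shows "conj_prod G t k (a \<otimes> b) = conj_prod G t k a \<otimes> conj_prod G t k b"
  using assms(3)
proof (induction k)
  case (Suc k)
  let ?D = "conj_prod G t k" and ?c = "conjugate G (t [^] k)"
  have in_carrier: "?D a \<in> carrier G" "?D b \<in> carrier G" "?c a \<in> carrier G" "?c b \<in> carrier G"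
    using ab R_carrier t_carrier by auto
  have commute: "?D b \<otimes> ?c a = ?c a \<otimes> ?D b"
    using conj_prod_in_centralizer[OF ab(2), of k k] Suc.prems ab(1) by (auto simp: centralizer_def)
  have "conj_prod G t (Suc k) (a \<otimes> b) = ?D a \<otimes> ?D b \<otimes> (?c a \<otimes> ?c b)"
    using Suc ab R_carrier t_carrier by (simp add: conj_prod_Suc conjugate_mult)
  also have "\<dots> = ?D a \<otimes> (?D b \<otimes> ?c a) \<otimes> ?c b" using in_carrier by (simp add: m_assoc)
  also have "\<dots> = (?D a \<otimes> ?c a) \<otimes> (?D b \<otimes> ?c b)" using in_carrier by (simp add: commute m_assoc)
  finally show ?case using ab R_carrier t_carrier by (simp add: conj_prod_Suc)
qed simp

definition diag :: "'a \<Rightarrow> 'a" where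
  "diag = conj_prod G t p"

lemma diag_hom: "diag \<in> hom (G\<lparr>carrier := R\<rparr>) G"
  using R_carrier t_carrier by (auto simp: hom_def diag_def conj_prod_mult)

lemma diag_decompose:
  assumes a: "a \<in> R"
  obtains e where "e \<in> centralizer G R" "diag a = a \<otimes> e"
proof
  define q where "q = p - 1"
  then have q: "p = Suc q" using p_gt_1 by simp
  let ?e = "conjugate G t (conj_prod G t q a)"
  have "conj_prod G t q a \<in> centralizer G (conjugate G (t [^] q) ` R)"
    using conj_prod_in_centralizer[OF a] q by simp
  then have "?e \<in> centralizer G (conjugate G (t [^] (1::nat)) ` conjugate G (t [^] q) ` R)"
    using conjugate_centralizer[of t] R_carrier t_carrier by (simp add: image_subset_iff)
  then have "?e \<in> centralizer G (conjugate G (t [^] p) ` R)"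
    by (simp only: conjugate_pow_image q plus_1_eq_Suc)
  moreover have "conjugate G (t [^] p) ` R = R" using R_carrier by (force simp: t_pow_p)
  ultimately show "?e \<in> centralizer G R" by simp
  show "diag a = a \<otimes> ?e"
    using conj_prod_Suc_left[OF t_carrier R_carrier[OF a], of q] by (simp add: diag_def flip: q)
qed

lemma diag_commutes_t:
  assumes a: "a \<in> R"
  shows "diag a \<in> centralizer G {t}"
proof -
  have in_carrier: "a \<in> carrier G" "diag a \<in> carrier G"
    using a R_carrier t_carrier by (auto simp: diag_def)
  obtain e where e: "e \<in> centralizer G R" "diag a = a \<otimes> e" using diag_decompose[OF a] .
  have "e \<otimes> a = a \<otimes> e" "e \<in> carrier G" using e(1) a by (auto simp: centralizer_def)
  then have "a \<otimes> diag a = diag a \<otimes> a" using e(2) in_carrier by (simp add: m_assoc)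
  also have "\<dots> = conj_prod G t (Suc p) a"
    using in_carrier t_carrier by (simp add: conj_prod_Suc diag_def t_pow_p)
  also have "\<dots> = a \<otimes> conjugate G t (diag a)"
    using in_carrier t_carrier by (simp add: conj_prod_Suc_left diag_def)
  finally have "conjugate G t (diag a) = diag a" using in_carrier t_carrier by simp
  then show ?thesis using in_carrier t_carrier by (simp add: conjugate_eq_iff centralizer_def)
qed

lemma diag_eq_one_imp_central:
  assumes a: "a \<in> R" and "diag a = \<one>"
  shows "a \<in> centralizer G R"
proof -
  obtain e where e: "e \<in> centralizer G R" "diag a = a \<otimes> e" using diag_decompose[OF a] .
  then have "a = inv e" using assms inv_equality[of a e] R_carrier by (simp add: centralizer_def)
  then show ?thesis
    using e(1) subgroup.m_inv_closed[OF centralizer_subgroup] R_carrier by blast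
qed

definition diag_group :: "'a set" where
  "diag_group = generate G (insert t (diag ` R))"

lemma diag_group_generators: "insert t (diag ` R) \<subseteq> carrier G"
  using R_carrier t_carrier by (auto simp: diag_def)

lemma diag_group_centralizes_t: "diag_group \<subseteq> centralizer G {t}"
  unfolding diag_group_def using diag_commutes_t t_carrier
  by (intro generate_subset_centralizer) (auto simp: centralizer_def)

lemma diag_group_finitely_generated:
  assumes "finitely_generated G R"
  shows "finitely_generated G diag_group"
proof -
  obtain S where S: "S \<subseteq> carrier G" "finite S" "generate G S = R"
    using assms by (auto simp: finitely_generated_def)
  have S_subset_R: "S \<subseteq> R" using S(3) by (auto intro: generate.incl)
  let ?W = "insert t (diag ` S)"
  have W: "?W \<subseteq> carrier G" using diag_group_generators S_subset_R by blast
  interpret diag: group_hom "G\<lparr>carrier := R\<rparr>" G diag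
    by (intro group_hom.intro group_hom_axioms.intro subgroup_imp_group R_subgroup
        diag_hom is_group)
  have "diag ` R = generate G (diag ` S)"
    using diag.generate_img[of S] generate_consistent[OF S_subset_R R_subgroup] S_subset_R S(3)
    by simp
  then have "insert t (diag ` R) \<subseteq> generate G ?W"
    using mono_generate[of "diag ` S" ?W] by (auto intro: generate.incl)
  then have "diag_group \<subseteq> generate G ?W"
    unfolding diag_group_def by (rule generate_subgroup_incl[OF _ generate_is_subgroup[OF W]])
  moreover have "generate G ?W \<subseteq> diag_group"
    unfolding diag_group_def using S_subset_R by (intro mono_generate) auto
  ultimately show ?thesis using W S(2) by (auto simp: finitely_generated_def intro!: exI[of _ ?W])
qed

end

locale diagonal_retraction = commuting_conjugates + virtual_retraction +
  assumes H_eq: "H = diag_group"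
    and center: "R \<inter> centralizer G R \<subseteq> {\<one>}"
begin

lemma t_pow_in_K: "t [^] (i::nat) \<in> K"
proof -
  have "t \<in> K" using H_subset_K by (auto simp: H_eq diag_group_def intro: generate.incl)
  then have "t [^] int i \<in> K" by (rule subgroup_int_pow_closed[OF K_subgroup])
  then show ?thesis by (simp add: int_pow_int)
qed

lemma ker_Int_R: "ker \<inter> R \<subseteq> {\<one>}"
proof
  fix c assume c: "c \<in> ker \<inter> R"
  have "conj_prod G t k c \<in> ker" for k
  proof (induction k)
    case (Suc k)
    have "conjugate G (t [^] k) c \<in> ker" using c ker_conjugate[OF t_pow_in_K] by blast
    then show ?case
      using Suc c R_carrier t_carrier subgroup.m_closed[OF ker_subgroup]
      by (simp add: conj_prod_Suc)
  qed (simp add: subgroup.one_closed[OF ker_subgroup])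
  then have "diag c \<in> ker" by (simp add: diag_def)
  moreover have "diag c \<in> H" using c by (auto simp: H_eq diag_group_def intro: generate.incl)
  ultimately have "diag c = \<one>" by (rule ker_Int_H)
  then show "c \<in> {\<one>}" using c diag_eq_one_imp_central center by blast
qed

text \<open>Write \<open>x = n h\<close> with \<open>n \<in> ker\<close> and \<open>h \<in> H\<close>. As \<open>h\<close> commutes with \<open>t\<close>, it is the product
  of the conjugates of \<open>n\<^sup>-\<^sup>1\<close> and \<open>x\<close> by \<open>t\<close>, both of which centralize \<open>R\<close>.\<close>

lemma K_Int_R:
  assumes ker: "ker \<subseteq> centralizer G R"
  shows "K \<inter> R \<subseteq> {\<one>}"
proof
  fix x assume x: "x \<in> K \<inter> R"
  let ?n = "x \<otimes> inv r x"
  have C: "subgroup (centralizer G R) G" using R_carrier by (intro centralizer_subgroup) auto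
  have n: "?n \<in> ker" using ker_component x by blast
  have rx: "r x \<in> H" using r_closed x by blast
  have in_carrier: "x \<in> carrier G" "r x \<in> carrier G" "?n \<in> carrier G"
    using x R_carrier subgroup.mem_carrier[OF H_subgroup rx] by auto
  have rx_eq: "r x = inv ?n \<otimes> x" using in_carrier by (simp add: inv_mult_group m_assoc)
  have "conjugate G t (r x) = r x"
    using rx diag_group_centralizes_t in_carrier t_carrier
    by (auto simp: H_eq conjugate_eq_iff centralizer_def)
  then have "r x = conjugate G t (inv ?n) \<otimes> conjugate G t x"
    using rx_eq in_carrier t_carrier conjugate_mult[of t "inv ?n" x] by simp
  moreover have "conjugate G t (inv ?n) \<in> centralizer G R"
    using ker ker_conjugate[OF t_pow_in_K[of 1]] subgroup.m_inv_closed[OF ker_subgroup n] t_carrier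
    by auto
  moreover have "conjugate G t x \<in> centralizer G R"
    using conjugates_commute[of 1] p_gt_1 x t_carrier by auto
  ultimately have "r x \<in> centralizer G R" using subgroup.m_closed[OF C] by metis
  moreover have "x = ?n \<otimes> r x" using in_carrier by (simp add: m_assoc)
  ultimately have "x \<in> centralizer G R" using ker n subgroup.m_closed[OF C] by (metis subsetD)
  then show "x \<in> {\<one>}" using x center by blast
qed

end

section \<open>Elements of prime order\<close>

context group
begin

lemma prime_order_power_exists:
  fixes k :: nat
  assumes x: "x \<in> carrier G" "x \<noteq> \<one>" and k: "k > 0" "x [^] k = \<one>"
  obtains t :: 'a and p :: nat
  where "t \<in> carrier G" "Factorial_Ring.prime p" "t [^] p = \<one>" "t \<noteq> \<one>"
proof -
  have "ord x dvd k" using k(2) pow_eq_id x(1) by blast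
  then have ord_pos: "ord x > 0" using k(1) by (auto intro: dvd_pos_nat)
  have "ord x \<noteq> 1" using ord_eq_1 x by blast
  then obtain p where p: "Factorial_Ring.prime p" "p dvd ord x" using prime_factor_nat by blast
  show ?thesis
  proof
    show "(x [^] (ord x div p)) [^] p = \<one>" using p(2) x(1) by (simp add: nat_pow_pow)
    have "ord x div p < ord x" "0 < ord x div p"
      using p ord_pos prime_gt_1_nat[OF p(1)] by (auto elim!: dvdE)
    then show "x [^] (ord x div p) \<noteq> \<one>" using pow_eq_id x(1) nat_dvd_not_less by blast
  qed (use x p in auto)
qed

lemma mem_subgroup_if_coprime_powers:
  fixes i j :: nat
  assumes H: "subgroup H G" and x: "x \<in> carrier G" and "coprime i j"
    and pow: "x [^] i \<in> H" "x [^] j \<in> H"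
  shows "x \<in> H"
proof -
  obtain a b where "a * int i + b * int j = 1"
    using bezout_int[of "int i" "int j"] assms(3) by auto
  then have "x = x [^] (int i * a + int j * b)" using x by (simp add: mult.commute)
  also have "\<dots> = (x [^] i) [^] a \<otimes> (x [^] j) [^] b"
    using x by (simp add: int_pow_mult int_pow_pow flip: int_pow_int)
  finally show ?thesis
    using pow subgroup.m_closed[OF H] subgroup_int_pow_closed[OF H] by metis
qed

end

section \<open>Automorphisms of the tree\<close>

lemma permutes_disjoint_commute:
  assumes f: "f permutes S" and g: "g permutes T" and "S \<inter> T = {}"
  shows "f \<circ> g = g \<circ> f"
proof
  fix w
  show "(f \<circ> g) w = (g \<circ> f) w"
    using permutes_not_in[OF f] permutes_not_in[OF g] permutes_in_image[OF f, of w]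
      permutes_in_image[OF g, of w] assms(3)[unfolded disjoint_iff]
    by (cases "w \<in> S"; cases "w \<in> T") auto
qed

lemma permutes_disjoint_eq_id: "f permutes S \<Longrightarrow> f permutes T \<Longrightarrow> S \<inter> T = {} \<Longrightarrow> f = id"
  using permutes_not_in[of f] by (intro ext) (auto simp: disjoint_iff)

lemma tree_aut_iff:
  "g \<in> tree_aut m \<longleftrightarrow> g permutes verts m \<and> g [] = [] \<and>
     (\<forall>u\<in>verts m. \<forall>w\<in>verts m. adjacent (g u) (g w) \<longleftrightarrow> adjacent u w)"
proof -
  have "g permutes verts m \<longleftrightarrow> bij_betw g (verts m) (verts m) \<and> (\<forall>x. x \<notin> verts m \<longrightarrow> g x = x)"
    using bij_imp_permutes[of g "verts m"] permutes_imp_bij[of g "verts m"]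
      permutes_not_in[of g "verts m"] by blast
  then show ?thesis by (auto simp: tree_aut_def)
qed

lemma tree_aut_permutes: "g \<in> tree_aut m \<Longrightarrow> g permutes verts m"
  by (simp add: tree_aut_iff)

lemma tree_aut_id: "id \<in> tree_aut m"
  by (simp add: tree_aut_iff permutes_id)

lemma tree_aut_comp: "g \<in> tree_aut m \<Longrightarrow> h \<in> tree_aut m \<Longrightarrow> g \<circ> h \<in> tree_aut m"
  by (simp add: tree_aut_iff permutes_compose permutes_in_image)

lemma tree_aut_inv:
  assumes g: "g \<in> tree_aut m"
  shows "inv' g \<in> tree_aut m"
proof -
  have p: "g permutes verts m" using g by (rule tree_aut_permutes)
  have "adjacent (inv' g u) (inv' g w) \<longleftrightarrow> adjacent u w"
    if "u \<in> verts m" "w \<in> verts m" for u w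
    using g that permutes_in_image[OF permutes_inv[OF p]] permutes_inverses(1)[OF p]
    unfolding tree_aut_iff by metis
  moreover have "inv' g [] = []"
    using g by (simp add: permutes_inv_eq[OF p] tree_aut_iff)
  ultimately show ?thesis using permutes_inv[OF p] by (simp add: tree_aut_iff)
qed

lemma AutT_simps [simp]:
  "carrier (AutT m) = tree_aut m" "x \<otimes>\<^bsub>AutT m\<^esub> y = x \<circ> y" "\<one>\<^bsub>AutT m\<^esub> = id"
  by (simp_all add: AutT_def)

lemma group_AutT: "group (AutT m)"
proof (rule groupI)
  fix x assume x: "x \<in> carrier (AutT m)"
  have "inv' x \<circ> x = id" using x permutes_inv_o(2)[OF tree_aut_permutes] by simp
  then show "\<exists>y\<in>carrier (AutT m). y \<otimes>\<^bsub>AutT m\<^esub> x = \<one>\<^bsub>AutT m\<^esub>"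
    using x tree_aut_inv by auto
qed (auto simp: tree_aut_comp tree_aut_id comp_assoc)

lemma verts_appendD:
  assumes "u @ w \<in> verts m"
  shows "u \<in> verts m"
  unfolding verts_def
proof (intro CollectI allI impI)
  fix i assume "i < length u"
  then show "u ! i < m i" using assms by (auto simp: verts_def nth_append dest!: spec[of _ i])
qed

lemma tree_aut_child:
  assumes g: "g \<in> tree_aut m" and "u @ [a] \<in> verts m"
  shows "\<exists>b. g (u @ [a]) = g u @ [b]"
  using assms(2)
proof (induction u arbitrary: a rule: rev_induct)
  case Nil
  have "[] \<in> verts m" by (simp add: verts_def)
  then have "adjacent (g []) (g [a])" using g Nil by (fastforce simp: tree_aut_iff adjacent_def)
  then show ?case using g by (auto simp: adjacent_def tree_aut_iff)
next
  case (snoc c u)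
  let ?w = "u @ [c]"
  have w: "?w \<in> verts m" by (rule verts_appendD[OF snoc.prems])
  have "adjacent ?w (?w @ [a])" by (auto simp: adjacent_def)
  then have "adjacent (g ?w) (g (?w @ [a]))" using g w snoc.prems by (auto simp: tree_aut_iff)
  moreover have "g ?w \<noteq> g (?w @ [a]) @ [b]" for b
  proof
    assume "g ?w = g (?w @ [a]) @ [b]"
    then have "g u = g (?w @ [a])" using snoc.IH[OF w] by auto
    then have "u = ?w @ [a]" using permutes_inj[OF tree_aut_permutes[OF g]] by (simp add: inj_eq)
    then show False by simp
  qed
  ultimately show ?case unfolding adjacent_def by blast
qed

lemma tree_aut_append:
  assumes g: "g \<in> tree_aut m" and "u @ w \<in> verts m"
  shows "\<exists>w'. g (u @ w) = g u @ w' \<and> length w' = length w"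
  using assms(2)
proof (induction w rule: rev_induct)
  case (snoc a w)
  then have "(u @ w) @ [a] \<in> verts m" by simp
  from tree_aut_child[OF g this] snoc.IH verts_appendD[OF this] show ?case by force
qed simp

lemma tree_aut_length: "g \<in> tree_aut m \<Longrightarrow> w \<in> verts m \<Longrightarrow> length (g w) = length w"
  using tree_aut_append[of g m "[]" w] by (auto simp: tree_aut_iff)

lemma tree_aut_subtree:
  assumes g: "g \<in> tree_aut m" and "w \<in> subtree m v"
  shows "g w \<in> subtree m (g v)"
proof -
  obtain u where u: "w = v @ u" "v @ u \<in> verts m" using assms(2) by (auto simp: subtree_def)
  then show ?thesis
    using tree_aut_append[OF g u(2)] permutes_in_image[OF tree_aut_permutes[OF g]]
    by (auto simp: subtree_def)
qed

lemma subtree_disjoint: "length u = length v \<Longrightarrow> u \<noteq> v \<Longrightarrow> subtree m u \<inter> subtree m v = {}"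
  by (auto simp: subtree_def)

lemma subtree_mono: "u \<in> subtree m v \<Longrightarrow> subtree m u \<subseteq> subtree m v"
  by (auto simp: subtree_def)

lemma subtree_self: "v \<in> verts m \<Longrightarrow> v \<in> subtree m v"
  by (auto simp: subtree_def)

lemma subtree_verts: "w \<in> subtree m v \<Longrightarrow> w \<in> verts m"
  by (simp add: subtree_def)

lemma restrict_id_subtree_comp:
  assumes "y \<in> tree_aut m" "y v = v"
  shows "restrict_id (x \<circ> y) (subtree m v) =
    restrict_id x (subtree m v) \<circ> restrict_id y (subtree m v)"
  using tree_aut_subtree[OF assms(1), of _ v] assms(2) by (auto simp: restrict_id_def fun_eq_iff)

section \<open>Rigid stabilizers\<close>

locale tree_group =
  fixes m :: "nat \<Rightarrow> nat" and G :: "(nat list \<Rightarrow> nat list) set"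
  assumes G_subgroup: "subgroup G (AutT m)"
begin

abbreviation \<Gamma> :: "(nat list \<Rightarrow> nat list) monoid" where
  "\<Gamma> \<equiv> (AutT m)\<lparr>carrier := G\<rparr>"

sublocale group \<Gamma>
  by (rule group.subgroup_imp_group[OF group_AutT G_subgroup])

lemma G_tree_aut: "g \<in> G \<Longrightarrow> g \<in> tree_aut m"
  using subgroup.mem_carrier[OF G_subgroup] by simp

lemma G_permutes: "g \<in> G \<Longrightarrow> g permutes verts m"
  by (rule tree_aut_permutes[OF G_tree_aut])

lemma apply_inv: "g \<in> G \<Longrightarrow> g ((inv\<^bsub>\<Gamma>\<^esub> g) w) = w"
  using fun_cong[OF r_inv[of g], of w] by simp

lemma inv_apply: "g \<in> G \<Longrightarrow> (inv\<^bsub>\<Gamma>\<^esub> g) (g w) = w"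
  using fun_cong[OF l_inv[of g], of w] by simp

lemma inv_in_G: "g \<in> G \<Longrightarrow> inv\<^bsub>\<Gamma>\<^esub> g \<in> G"
  using inv_closed[of g] by simp

lemma conjugate_apply: "conjugate \<Gamma> g x w = g (x ((inv\<^bsub>\<Gamma>\<^esub> g) w))"
  by (simp add: conjugate_def)

lemma stabilizer_subgroup: "subgroup {g \<in> G. g v = v} \<Gamma>"
proof (rule subgroupI)
  have "id \<in> {g \<in> G. g v = v}" using one_closed by simp
  then show "{g \<in> G. g v = v} \<noteq> {}" by blast
  fix g assume g: "g \<in> {g \<in> G. g v = v}"
  then have "(inv\<^bsub>\<Gamma>\<^esub> g) v = v" using inv_apply[of g v] by simp
  then show "inv\<^bsub>\<Gamma>\<^esub> g \<in> {g \<in> G. g v = v}" using g inv_in_G by simp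
  show "g \<otimes>\<^bsub>\<Gamma>\<^esub> h \<in> {g \<in> G. g v = v}" if "h \<in> {g \<in> G. g v = v}" for h
    using g that m_closed[of g h] by simp
qed auto

lemma rist_iff: "x \<in> rist m G v \<longleftrightarrow> x \<in> G \<and> x permutes subtree m v"
proof
  assume x: "x \<in> rist m G v"
  then have "x permutes subtree m v"
    using permutes_superset[OF G_permutes, of x "subtree m v"] by (simp add: rist_def)
  then show "x \<in> G \<and> x permutes subtree m v" using x by (simp add: rist_def)
qed (auto simp: rist_def permutes_not_in)

lemma rist_subset_G: "rist m G v \<subseteq> G"
  by (auto simp: rist_def)

lemma rist_subgroup: "subgroup (rist m G v) \<Gamma>"
proof -
  let ?W = "verts m - subtree m v"
  have "rist m G v = G \<inter> (\<Inter>w\<in>?W. {g \<in> G. g w = w})" by (auto simp: rist_def)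
  moreover have "subgroup (\<Inter> (insert G ((\<lambda>w. {g \<in> G. g w = w}) ` ?W))) \<Gamma>"
    using subgroup_self stabilizer_subgroup by (intro subgroups_Inter) auto
  ultimately show ?thesis by simp
qed

lemma rist_mono: "u \<in> subtree m v \<Longrightarrow> rist m G u \<subseteq> rist m G v"
  using subtree_mono[of u m v] by (auto simp: rist_def)

lemma conjugate_rist:
  assumes g: "g \<in> G" and x: "x \<in> rist m G v"
  shows "conjugate \<Gamma> g x \<in> rist m G (g v)"
proof -
  have x_in_G: "x \<in> G" using x rist_subset_G by blast
  have "conjugate \<Gamma> g x w = w" if "w \<notin> subtree m (g v)" for w
  proof -
    have "(inv\<^bsub>\<Gamma>\<^esub> g) w \<notin> subtree m v"
      using tree_aut_subtree[OF G_tree_aut[OF g]] that apply_inv[OF g] by metis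
    then have "x ((inv\<^bsub>\<Gamma>\<^esub> g) w) = (inv\<^bsub>\<Gamma>\<^esub> g) w" using x permutes_not_in by (auto simp: rist_iff)
    then show ?thesis by (simp add: conjugate_apply apply_inv[OF g])
  qed
  moreover have "conjugate \<Gamma> g x \<in> G" using g x_in_G conjugate_closed[of g x] by simp
  ultimately show ?thesis by (simp add: rist_def)
qed

lemma rist_commute:
  assumes "length u = length v" "u \<noteq> v"
  shows "rist m G u \<subseteq> centralizer \<Gamma> (rist m G v)"
  using permutes_disjoint_commute[OF _ _ subtree_disjoint[OF assms]]
  by (fastforce simp: centralizer_def rist_iff)

lemma rist_fixes_level:
  assumes x: "x \<in> rist m G v" and u: "u \<in> verts m" "length u = length v"
  shows "x u = u"
proof (cases "u = v")
  case True
  have "x v \<in> subtree m v"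
    using x subtree_self u(1) True permutes_in_image by (metis rist_iff)
  moreover have "length (x v) = length v"
    using x u True rist_subset_G G_tree_aut tree_aut_length by blast
  ultimately show ?thesis using True by (auto simp: subtree_def)
next
  case False
  then have "u \<notin> subtree m v" using u by (auto simp: subtree_def)
  then show ?thesis using x u by (simp add: rist_def)
qed

lemma restrict_id_rist:
  assumes "x \<in> rist m G u" "length u = length v"
  shows "restrict_id x (subtree m v) = (if u = v then x else id)"
proof -
  have "x w = w" if "w \<notin> subtree m u" for w
    using assms(1) that permutes_not_in by (auto simp: rist_iff)
  then show ?thesis
    using subtree_disjoint[OF assms(2), of m] by (auto simp: restrict_id_def fun_eq_iff)
qed

lemma Rist_eq_generate: "Rist m G n = generate \<Gamma> (\<Union>v\<in>level m n. rist m G v)"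
  unfolding Rist_def using rist_subset_G
  by (intro group.generate_consistent[OF group_AutT _ G_subgroup, symmetric]) auto

lemma Rist_restrict_id:
  assumes v: "v \<in> verts m" and x: "x \<in> Rist m G (length v)"
  shows "x v = v" "restrict_id x (subtree m v) \<in> rist m G v"
proof -
  let ?\<pi> = "\<lambda>x. restrict_id x (subtree m v)"
  have one: "id \<in> rist m G v" using subgroup.one_closed[OF rist_subgroup] by simp
  have rist: "x \<in> G \<and> x v = v \<and> ?\<pi> x \<in> rist m G v"
    if "x \<in> rist m G u" "u \<in> level m (length v)" for x u
    using that v one rist_fixes_level restrict_id_rist[OF that(1), of v] subsetD[OF rist_subset_G]
    by (auto simp: level_def)
  have "x \<in> G \<and> x v = v \<and> ?\<pi> x \<in> rist m G v"
    using x unfolding Rist_eq_generate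
  proof (induction rule: generate.induct)
    case one
    then show ?case using \<open>id \<in> rist m G v\<close> one_closed by (auto simp: restrict_id_def id_def)
  next
    case (incl h)
    then show ?case using rist by blast
  next
    case (inv h)
    then show ?case using rist subgroup.m_inv_closed[OF rist_subgroup] by blast
  next
    case (eng h1 h2)
    have "?\<pi> (h1 \<circ> h2) = ?\<pi> h1 \<circ> ?\<pi> h2"
      using eng.IH by (intro restrict_id_subtree_comp G_tree_aut) auto
    moreover have "?\<pi> h1 \<circ> ?\<pi> h2 \<in> rist m G v"
      using eng.IH subgroup.m_closed[OF rist_subgroup[of v], of "?\<pi> h1" "?\<pi> h2"] by simp
    moreover have "h1 \<circ> h2 \<in> G" "(h1 \<circ> h2) v = v" using eng.IH m_closed[of h1 h2] by simp_all
    ultimately show ?case by (simp add: o_def)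
  qed
  then show "x v = v" "restrict_id x (subtree m v) \<in> rist m G v" by auto
qed

lemma centralizes_rist_if_fixes_subtree:
  assumes n: "n \<in> G" and "\<And>w. w \<in> subtree m v \<Longrightarrow> n w = w"
  shows "n \<in> centralizer \<Gamma> (rist m G v)"
proof -
  have "n permutes verts m - subtree m v"
    using assms(2) by (intro permutes_superset[OF G_permutes[OF n]]) auto
  then have "n \<circ> x = x \<circ> n" if "x \<in> rist m G v" for x
    using that permutes_disjoint_commute[of n _ x "subtree m v"] by (auto simp: rist_iff)
  then show ?thesis using n by (simp add: centralizer_def)
qed

lemma LR_imp_has_local_retractions:
  assumes "LR m G"
  shows "has_local_retractions \<Gamma>"
  unfolding has_local_retractions_def
proof (intro allI impI)
  fix H assume H: "finitely_generated \<Gamma> H"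
  have H_subgroup: "subgroup H \<Gamma>" by (rule finitely_generated_imp_subgroup[OF H])
  have "finitely_generated (AutT m) H"
    using H group.finitely_generated_consistent[OF group_AutT G_subgroup]
      subgroup.subset[OF H_subgroup] by simp
  then have "fin_gen m H"
    by (auto simp: finitely_generated_def fin_gen_def intro: generate.incl)
  then have "virtual_retract m H G" using assms H_subgroup by (simp add: LR_def)
  then obtain K r where "finite_index m K G" "H \<subseteq> K"
    "r \<in> hom (\<Gamma>\<lparr>carrier := K\<rparr>) (\<Gamma>\<lparr>carrier := H\<rparr>)" "\<forall>h\<in>H. r h = h"
    by (auto simp: virtual_retract_def)
  then have "virtual_retraction \<Gamma> K H r"
    using H_subgroup is_group
    by (intro virtual_retraction.intro virtual_retraction_axioms.intro)
      (auto simp: finite_index_def finite_index_subgroup_def)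
  then show "\<exists>K r. virtual_retraction \<Gamma> K H r" by blast
qed

end

section \<open>Branch groups\<close>

locale branch_group = tree_group +
  assumes m_ge_2: "m n \<ge> 2"
    and G_fin_gen: "fin_gen m G"
    and G_branch: "branch m G"
begin

lemma transitive:
  assumes "u \<in> verts m" "w \<in> verts m" "length u = length w"
  obtains g where "g \<in> G" "g u = w"
  using G_branch assms by (fastforce simp: branch_def level_transitive_def level_def)

lemma finitely_generated_G: "finitely_generated \<Gamma> G"
proof -
  have "finitely_generated (AutT m) G"
    using G_fin_gen G_tree_aut by (auto simp: fin_gen_def finitely_generated_def)
  then show ?thesis
    using group.finitely_generated_consistent[OF group_AutT G_subgroup] by simp
qed

lemma Rist_finite_index: "v \<noteq> [] \<Longrightarrow> finite_index_subgroup (Rist m G (length v)) \<Gamma>"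
  using G_branch by (simp add: branch_def finite_index_def finite_index_subgroup_def Suc_leI)

lemma verts_append_binary:
  assumes "u \<in> verts m" "set w \<subseteq> {0, 1}"
  shows "u @ w \<in> verts m"
  unfolding verts_def
proof (intro CollectI allI impI)
  fix i assume i: "i < length (u @ w)"
  show "(u @ w) ! i < m i"
  proof (cases "i < length u")
    case True
    then show ?thesis using assms(1) by (simp add: verts_def nth_append)
  next
    case False
    then have "w ! (i - length u) \<in> set w" using i by (intro nth_mem) simp
    then have "w ! (i - length u) \<le> 1" using assms(2) by auto
    then show ?thesis using False m_ge_2[of i] by (simp add: nth_append)
  qed
qed

lemma binary_verts: "set w \<subseteq> {0, 1} \<Longrightarrow> w \<in> verts m"
  using verts_append_binary[of "[]" w] by (simp add: verts_def)

lemma infinite_G: "infinite G"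
proof
  assume fin: "finite G"
  define n where "n = Suc (card G)"
  define u :: "nat list" where "u = replicate n 0"
  have u: "u \<in> verts m" and in_verts: "u[i := 1] \<in> verts m" for i
    using set_update_subset_insert[of u i 1] by (auto simp: u_def intro!: binary_verts)
  have "(\<lambda>i. u[i := 1]) ` {..<n} \<subseteq> (\<lambda>g. g u) ` G"
  proof
    fix w assume "w \<in> (\<lambda>i. u[i := 1]) ` {..<n}"
    then obtain i where i: "w = u[i := 1]" by blast
    then obtain g where "g \<in> G" "g u = w" using transitive[OF u in_verts[of i]] by auto
    then show "w \<in> (\<lambda>g. g u) ` G" by blast
  qed
  moreover have "inj_on (\<lambda>i. u[i := 1]) {..<n}"
  proof
    fix i j assume "i \<in> {..<n}" "j \<in> {..<n}" "u[i := 1] = u[j := 1]"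
    then have "u[j := 1] ! i = 1" by (metis lessThan_iff length_replicate nth_list_update_eq u_def)
    then show "i = j" using \<open>i \<in> {..<n}\<close> by (cases "i = j") (simp_all add: u_def)
  qed
  ultimately have "n \<le> card G"
    using fin by (metis card_image card_lessThan card_mono finite_imageI card_image_le order_trans)
  then show False by (simp add: n_def)
qed

lemma rist_nontrivial:
  assumes u: "u \<in> verts m" "u \<noteq> []"
  shows "\<exists>x\<in>rist m G u. x \<noteq> id"
proof (rule ccontr)
  assume "\<not> ?thesis"
  then have triv: "rist m G u \<subseteq> {id}" by auto
  have "rist m G w \<subseteq> {id}" if w: "w \<in> level m (length u)" for w
  proof
    fix x assume x: "x \<in> rist m G w"
    then have x_in_G: "x \<in> G" using rist_subset_G by blast
    obtain g where g: "g \<in> G" "g w = u"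
      using transitive[of w u] u w by (auto simp: level_def)
    have "conjugate \<Gamma> g x = id" using conjugate_rist[OF g(1) x] g(2) triv by auto
    then show "x \<in> {id}" using g(1) x_in_G conjugate_eq_iff[of g x id] l_cancel_one[of g x] by simp
  qed
  moreover have "subgroup {id} \<Gamma>" using triv_subgroup by simp
  ultimately have Rist: "Rist m G (length u) \<subseteq> {id}"
    unfolding Rist_eq_generate by (intro generate_subgroup_incl) auto
  obtain x where "x \<in> Rist m G (length u)" "x \<noteq> \<one>\<^bsub>\<Gamma>\<^esub>"
    using finite_index_meets_infinite_subgroup[OF Rist_finite_index[OF u(2)] subgroup_self]
      infinite_G by auto
  then show False using Rist by auto
qed

lemma infinite_rist:
  assumes u: "u \<in> verts m"
  shows "infinite (rist m G u)"
proof -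
  define v where "v i = u @ replicate i 0 @ [1]" for i
  have v: "v i \<in> verts m" "v i \<noteq> []" for i
    unfolding v_def by (auto intro!: verts_append_binary[OF u])
  have disjoint: "subtree m (v i) \<inter> subtree m (v j) = {}" if "i < j" for i j
  proof -
    have "(v i @ y) ! (length u + i) = 1" "(v j @ z) ! (length u + i) = 0" for y z
      using that by (simp_all add: v_def nth_append)
    then have "v i @ y \<noteq> v j @ z" for y z by (metis zero_neq_one)
    then show ?thesis by (auto simp: subtree_def)
  qed
  have "\<forall>i. \<exists>x. x \<in> rist m G (v i) \<and> x \<noteq> id" using rist_nontrivial v by blast
  then obtain f where f: "\<And>i. f i \<in> rist m G (v i)" "\<And>i. f i \<noteq> id" by metis
  have "f i \<noteq> f j" if "i < j" for i j
    using permutes_disjoint_eq_id[OF _ _ disjoint[OF that], of "f i"] f(1)[of i] f(1)[of j] f(2)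
    by (auto simp: rist_iff)
  then have "inj f" by (metis injI linorder_neqE_nat)
  moreover have "range f \<subseteq> rist m G u"
    using f(1) v rist_mono[of "v _" u] by (fastforce simp: subtree_def v_def)
  ultimately show ?thesis using infinite_super range_inj_infinite by blast
qed

lemma finite_index_meets_rist:
  assumes "finite_index_subgroup K \<Gamma>" "u \<in> verts m"
  obtains x where "x \<in> K" "x \<in> rist m G u" "x \<noteq> id"
  using finite_index_meets_infinite_subgroup[OF assms(1) rist_subgroup infinite_rist[OF assms(2)]]
  by auto

text \<open>If \<open>n\<close> moves \<open>w\<close>, it conjugates a nontrivial element supported below \<open>w\<close> to one supported
  below \<open>n w\<close>, hence disjointly.\<close>

lemma fixes_subtree_if_centralizes:
  assumes K: "finite_index_subgroup K \<Gamma>" and n: "n \<in> centralizer \<Gamma> (K \<inter> rist m G u)"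
    and w: "w \<in> subtree m u"
  shows "n w = w"
proof (rule ccontr)
  assume moved: "n w \<noteq> w"
  have n_in_G: "n \<in> G" using n by (simp add: centralizer_def)
  have w_in_verts: "w \<in> verts m" by (rule subtree_verts[OF w])
  obtain b where b: "b \<in> K" "b \<in> rist m G w" "b \<noteq> id"
    using finite_index_meets_rist[OF K w_in_verts] .
  have "conjugate \<Gamma> n b = b"
    using n b rist_mono[OF w] rist_subset_G n_in_G conjugate_eq_iff[of n b b]
    by (auto simp: centralizer_def)
  then have "b \<in> rist m G (n w)" using conjugate_rist[OF n_in_G b(2)] by simp
  moreover have "subtree m w \<inter> subtree m (n w) = {}"
    using tree_aut_length[OF G_tree_aut[OF n_in_G] w_in_verts] moved
    by (intro subtree_disjoint) auto
  ultimately have "b = id" using b(2) permutes_disjoint_eq_id by (auto simp: rist_iff)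
  then show False using b(3) by simp
qed

lemma rist_Int_centralizer:
  assumes "finite_index_subgroup K \<Gamma>"
  shows "rist m G u \<inter> centralizer \<Gamma> (K \<inter> rist m G u) \<subseteq> {\<one>\<^bsub>\<Gamma>\<^esub>}"
proof
  fix x assume x: "x \<in> rist m G u \<inter> centralizer \<Gamma> (K \<inter> rist m G u)"
  have "x w = w" for w
    using x fixes_subtree_if_centralizes[OF assms] permutes_not_in[of x "subtree m u" w]
    by (cases "w \<in> subtree m u") (auto simp: rist_iff)
  then show "x \<in> {\<one>\<^bsub>\<Gamma>\<^esub>}" by auto
qed

lemma finitely_generated_rist:
  assumes v: "v \<in> verts m" "v \<noteq> []"
  shows "finitely_generated \<Gamma> (rist m G v)"
proof -
  let ?R = "Rist m G (length v)" and ?\<pi> = "\<lambda>x. restrict_id x (subtree m v)"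
  have R: "subgroup ?R \<Gamma>"
    using Rist_finite_index[OF v(2)] by (simp add: finite_index_subgroup_def)
  have "finitely_generated \<Gamma> ?R"
    using finitely_generated_finite_index[OF _ Rist_finite_index[OF v(2)]] finitely_generated_G
    by simp
  then have Rist_fin_gen: "finitely_generated (\<Gamma>\<lparr>carrier := ?R\<rparr>) ?R"
    using finitely_generated_consistent[OF R] by blast
  have "?\<pi> \<in> hom (\<Gamma>\<lparr>carrier := ?R\<rparr>) \<Gamma>"
    using Rist_restrict_id[OF v(1)] rist_subset_G subgroup.mem_carrier[OF R] G_tree_aut
      restrict_id_subtree_comp[of _ m v]
    by (auto simp: hom_def)
  then interpret \<pi>: group_hom "\<Gamma>\<lparr>carrier := ?R\<rparr>" \<Gamma> ?\<pi>
    by (intro group_hom.intro group_hom_axioms.intro subgroup_imp_group R is_group)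
  have "?\<pi> ` ?R = rist m G v"
  proof
    show "?\<pi> ` ?R \<subseteq> rist m G v" using Rist_restrict_id[OF v(1)] by blast
    have "rist m G v \<subseteq> ?R"
      unfolding Rist_def using v(1) by (auto simp: level_def intro!: generate.incl)
    then show "rist m G v \<subseteq> ?\<pi> ` ?R" using restrict_id_rist[of _ v v] by force
  qed
  then show ?thesis using \<pi>.finitely_generated_image[OF Rist_fin_gen] by simp
qed

lemma exists_moving:
  assumes v: "v \<in> verts m" "v \<noteq> []"
  obtains g where "g \<in> G" "g v \<noteq> v"
proof -
  define u where "u = butlast v @ [if last v = 0 then 1 else 0]"
  have "butlast v @ [last v] \<in> verts m" using v by simp
  then have "butlast v \<in> verts m" by (rule verts_appendD)
  then have "u \<in> verts m" unfolding u_def by (rule verts_append_binary) simp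
  moreover have "length v = length u" using v(2) by (simp add: u_def)
  moreover have "last u \<noteq> last v" by (simp add: u_def)
  ultimately show ?thesis using transitive[OF v(1)] that by metis
qed

lemma rist_torsion:
  assumes LR: "has_local_retractions \<Gamma>" and v: "v \<in> verts m" "v \<noteq> []" and s: "s \<in> rist m G v"
  shows "\<exists>k::nat>0. s [^]\<^bsub>\<Gamma>\<^esub> k = \<one>\<^bsub>\<Gamma>\<^esub>"
proof -
  obtain g where g: "g \<in> G" "g v \<noteq> v" using exists_moving[OF v] .
  have "length (g v) = length v" by (rule tree_aut_length[OF G_tree_aut[OF g(1)] v(1)])
  then have "conjugate \<Gamma> g ` rist m G v \<subseteq> centralizer \<Gamma> (rist m G v)"
    using conjugate_rist[OF g(1)] rist_commute g(2) by blast
  moreover have "conjugate \<Gamma> g \<in> hom (\<Gamma>\<lparr>carrier := rist m G v\<rparr>) \<Gamma>"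
    using conjugate_hom[of g] g(1) subsetD[OF rist_subset_G] by (auto simp: hom_def)
  moreover have "inj_on (conjugate \<Gamma> g) (rist m G v)"
    using inj_on_subset[OF inj_on_conjugate[of g]] g(1) rist_subset_G by simp
  ultimately show ?thesis
    using torsion_if_commuting_copy[OF LR finitely_generated_rist[OF v] rist_Int_centralizer] s
    by blast
qed

lemma commuting_conjugates_rist:
  fixes p :: nat
  assumes t: "t \<in> G" "Factorial_Ring.prime p" "t [^]\<^bsub>\<Gamma>\<^esub> p = \<one>\<^bsub>\<Gamma>\<^esub>"
    and v: "v \<in> verts m" "t v \<noteq> v"
  shows "commuting_conjugates \<Gamma> (rist m G v) t p"
proof (intro commuting_conjugates.intro commuting_conjugates_axioms.intro)
  have t_carrier: "t \<in> carrier \<Gamma>" using t(1) by simp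
  fix i :: nat assume i: "0 < i" "i < p"
  let ?s = "t [^]\<^bsub>\<Gamma>\<^esub> i"
  have s: "?s \<in> G" using nat_pow_closed[OF t_carrier, of i] by simp
  have "coprime p i"
    using t(2) i by (intro prime_imp_coprime) (auto dest: dvd_imp_le)
  moreover have "t [^]\<^bsub>\<Gamma>\<^esub> p \<in> {g \<in> G. g v = v}"
    unfolding t(3) by (rule subgroup.one_closed[OF stabilizer_subgroup])
  ultimately have "?s v \<noteq> v"
    using mem_subgroup_if_coprime_powers[OF stabilizer_subgroup t_carrier, of p i v] s v(2) by auto
  moreover have "length (?s v) = length v" by (rule tree_aut_length[OF G_tree_aut[OF s] v(1)])
  ultimately show "conjugate \<Gamma> ?s ` rist m G v \<subseteq> centralizer \<Gamma> (rist m G v)"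
    using conjugate_rist[OF s] rist_commute by blast
qed (use t is_group rist_subgroup prime_gt_1_nat in auto)

text \<open>The kernel contains the commutators of \<open>K \<inter> rist w\<close> for every \<open>w\<close> it moves.\<close>

lemma ker_centralizes_rist:
  assumes "virtual_retraction \<Gamma> K H r"
    and ker: "virtual_retraction.ker \<Gamma> K r \<inter> rist m G v \<subseteq> {\<one>\<^bsub>\<Gamma>\<^esub>}"
  shows "virtual_retraction.ker \<Gamma> K r \<subseteq> centralizer \<Gamma> (rist m G v)"
proof
  interpret r: virtual_retraction \<Gamma> K H r by fact
  fix n assume n: "n \<in> r.ker"
  have n_in_G: "n \<in> G" using subgroup.mem_carrier[OF r.ker_subgroup n] by simp
  show "n \<in> centralizer \<Gamma> (rist m G v)"
  proof (rule centralizes_rist_if_fixes_subtree[OF n_in_G], rule ccontr)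
    fix w assume w: "w \<in> subtree m v" and moved: "n w \<noteq> w"
    have w_in_verts: "w \<in> verts m" by (rule subtree_verts[OF w])
    obtain a where a: "a \<in> K" "a \<in> rist m G w" "a \<noteq> id"
      using finite_index_meets_rist[OF r.finite_index w_in_verts] .
    have a_in_G: "a \<in> G" using a(2) rist_subset_G by blast
    have "a \<notin> centralizer \<Gamma> (K \<inter> rist m G w)"
      using rist_Int_centralizer[OF r.finite_index] a(2,3) by auto
    then obtain b where b: "b \<in> K" "b \<in> rist m G w" "a \<circ> b \<noteq> b \<circ> a"
      using a_in_G by (auto simp: centralizer_def)
    have "conjugate \<Gamma> n (inv\<^bsub>\<Gamma>\<^esub> a) \<in> rist m G (n w)"
      by (intro conjugate_rist n_in_G subgroup.m_inv_closed[OF rist_subgroup] a(2))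
    then have "conjugate \<Gamma> n (inv\<^bsub>\<Gamma>\<^esub> a) \<in> centralizer \<Gamma> (rist m G w)"
      using rist_commute[of "n w" w] tree_aut_length[OF G_tree_aut[OF n_in_G] w_in_verts] moved
      by blast
    then have "commutator \<Gamma> a b \<in> r.ker"
      using b(2) by (intro r.ker_commutator[OF n a(1) b(1)]) (simp add: centralizer_def)
    moreover have "commutator \<Gamma> a b \<in> rist m G v"
      using commutator_in_subgroup[OF rist_subgroup a(2) b(2)] rist_mono[OF w] by blast
    ultimately have "commutator \<Gamma> a b = \<one>\<^bsub>\<Gamma>\<^esub>" using ker by blast
    then show False
      using commutator_eq_one_imp_commute[of a b] a_in_G b(2,3) subsetD[OF rist_subset_G] by simp
  qed
qed

lemma not_local_retractions_if_prime_order: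
  fixes p :: nat
  assumes t: "t \<in> G" "Factorial_Ring.prime p" "t [^]\<^bsub>\<Gamma>\<^esub> p = \<one>\<^bsub>\<Gamma>\<^esub>" "t \<noteq> id"
  shows "\<not> has_local_retractions \<Gamma>"
proof
  assume LR: "has_local_retractions \<Gamma>"
  obtain v where moves_v: "t v \<noteq> v" using t(4) by (auto simp: fun_eq_iff)
  have v: "v \<in> verts m" using moves_v permutes_not_in[OF G_permutes[OF t(1)]] by blast
  have "v \<noteq> []" using moves_v G_tree_aut[OF t(1)] by (auto simp: tree_aut_iff)
  interpret commuting_conjugates \<Gamma> "rist m G v" t p
    by (rule commuting_conjugates_rist[OF t(1-3) v moves_v])
  obtain K r where retraction: "virtual_retraction \<Gamma> K diag_group r"
    using LR diag_group_finitely_generated[OF finitely_generated_rist[OF v \<open>v \<noteq> []\<close>]]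
    by (auto simp: has_local_retractions_def)
  interpret r: virtual_retraction \<Gamma> K diag_group r by (fact retraction)
  have "rist m G v \<inter> centralizer \<Gamma> (rist m G v) \<subseteq> {\<one>\<^bsub>\<Gamma>\<^esub>}"
    using rist_Int_centralizer[OF r.finite_index, of v] by (auto simp: centralizer_def)
  then interpret diagonal_retraction \<Gamma> "rist m G v" t p K diag_group r
    by unfold_locales auto
  obtain x where "x \<in> K" "x \<in> rist m G v" "x \<noteq> id"
    using finite_index_meets_rist[OF r.finite_index v] .
  then show False using K_Int_R ker_centralizes_rist[OF retraction ker_Int_R] by auto
qed

end

theorem theoremA:
  fixes m :: "nat \<Rightarrow> nat" and G :: "(nat list \<Rightarrow> nat list) set"
  assumes "\<forall>n. m n \<ge> 2"
    and "subgroup G (AutT m)"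
    and "fin_gen m G"
    and "branch m G"
  shows "\<not> LR m G"
proof
  assume "LR m G"
  interpret branch_group m G
    using assms by (intro branch_group.intro tree_group.intro branch_group_axioms.intro) blast+
  have LR: "has_local_retractions \<Gamma>" by (rule LR_imp_has_local_retractions) fact
  obtain s where s: "s \<in> rist m G [0]" "s \<noteq> id" using rist_nontrivial[of "[0]"] binary_verts by auto
  then obtain k :: nat where k: "k > 0" "s [^]\<^bsub>\<Gamma>\<^esub> k = \<one>\<^bsub>\<Gamma>\<^esub>"
    using rist_torsion[OF LR, of "[0]"] binary_verts by auto
  have "s \<in> carrier \<Gamma>" "s \<noteq> \<one>\<^bsub>\<Gamma>\<^esub>" using s rist_subset_G by auto
  from this k obtain t and p :: nat
    where "t \<in> carrier \<Gamma>" "Factorial_Ring.prime p" "t [^]\<^bsub>\<Gamma>\<^esub> p = \<one>\<^bsub>\<Gamma>\<^esub>" "t \<noteq> \<one>\<^bsub>\<Gamma>\<^esub>"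
    by (rule prime_order_power_exists)
  then show False using not_local_retractions_if_prime_order LR by simp
qed

end
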